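(* Let $\{\mathbf{A}_{n,j;i},\ \mathbf{B}_n : n\in\mathbb{Z},\ j\in\{1,2,\dots\},\ i\in\{1,\dots,d\}\}$ be random vectors in $\mathbb{R}^d$ with non-negative integer coordinates such that, with $\mathbf{C}_n:=\{\mathbf{A}_{n,j;i}: j\in\{1,2,\dots\},\ i\in\{1,\dots,d\}\}$, the process $Z_n:=(\mathbf{C}_n,\mathbf{B}_n)$, $n\in\mathbb{Z}$, is stationary and ergodic. Let $\mathcal{F}_t$ be the sigma-algebra generated by $Z_j$, $-\infty<j\le t$, and assume that for each $i$ the vectors $\mathbf{A}_{1,j;i}$, $j\in\{1,2,\dots\}$, all have the same conditional law with respect to $\mathcal{F}_0$. Let $m_i:=\mathbb{E}[\mathbf{A}_{1,1;i}\mid\mathcal{F}_0]$, $i=1,\dots,d$. For $v$ with non-negative integer coordinates define the $d$-type Galton--Watson process with immigration $\mathbf{X}_n=\mathbf{X}_n(v)=(X_{n,1},\dots,X_{n,d})$ by $\mathbf{X}_0=v$ and $$\mathbf{X}_n=\sum_{j=1}^{X_{n-1,1}}\mathbf{A}_{n,j;1}+\dots+\sum_{j=1}^{X_{n-1,d}}\mathbf{A}_{n,j;d}+\mathbf{B}_n,\quad n\ge1.$$ If $$\max_{1\le i\le d}|m_i|_1\le\varrho$$ almost surely for some constant $\varrho<1$, and $\mathbb{E}\{|\mathbf{B}_1|_1\}<\infty$, then $\mathbf{X}_n(v)$ is strongly stable and the strong law of large numbers (SLLN) holds.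
   Context: $|x|_1=\sum_{i=1}^d|x_i|$ for $x\in\mathbb{R}^d$. An empty sum is $0$. Let $S$ denote the set of vectors in $\mathbb{R}^d$ with non-negative integer coordinates. For a random vector $V$ with values in $S$ (defined on the same probability space as $\{Z_n\}$, and allowed to depend on the entire trajectory of $\{Z_n\}$), $\mathbf{X}_n(V)$ denotes the process defined by the recursion with $\mathbf{X}_0=V$. Definition (strong stability). The class $\{\mathbf{X}_n(v),\ v\in S\}$ is called strongly stable if (I) there exists a random vector $V^*$ with values in $S$ such that $\{\mathbf{X}_i(V^* )\}_{i=0}^{\infty}$ is stationary and ergodic, and (II) for any random vector $V$ with values in $S$, $\mathbf{X}_n(V)-\mathbf{X}_n(V^* )\to0$ almost surely as $n\to\infty$. Definition (SLLN). A strongly stable class satisfies the strong law of large numbers if $\mathbb{E}\{V^*\}$ is well-defined and finite and, for any $v\in S$, $\lim_n\frac1n\sum_{i=1}^n\mathbf{X}_i(v)=\mathbb{E}\{V^*\}$ almost surely. *)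

theory Defs
  imports "HOL-Probability.Probability"
begin

text \<open>
  The set of vectors of \<open>\<real>\<^sup>d\<close> with non-negative integer coordinates is represented by the
  type \<open>nat ^ 'd\<close>, with the discrete sigma-algebra; \<open>real_vec\<close> is the embedding into \<open>\<real>\<^sup>d\<close>.
\<close>

definition real_vec :: "nat ^ 'd \<Rightarrow> real ^ 'd" where
  "real_vec x = (\<chi> k. real (x $ k))"

definition l1_norm :: "real ^ 'd \<Rightarrow> real" where
  "l1_norm x = (\<Sum>k\<in>UNIV. \<bar>x $ k\<bar>)"


text \<open>
  Stationarity and ergodicity are properties of the law on path space, and the index type
  is \<open>nat\<close> (one-sided) or \<open>int\<close> (two-sided).
\<close>

definition path_space :: "'s measure \<Rightarrow> ('i \<Rightarrow> 's) measure" where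
  "path_space N = PiM UNIV (\<lambda>_. N)"

definition path_law :: "'w measure \<Rightarrow> 's measure \<Rightarrow> ('i \<Rightarrow> 'w \<Rightarrow> 's) \<Rightarrow> ('i \<Rightarrow> 's) measure" where
  "path_law M N Z = distr M (path_space N) (\<lambda>\<omega> n. Z n \<omega>)"

definition shift :: "('i::{plus,one} \<Rightarrow> 's) \<Rightarrow> 'i \<Rightarrow> 's" where
  "shift x = (\<lambda>n. x (n + 1))"

definition stationary_process ::
    "'w measure \<Rightarrow> 's measure \<Rightarrow> ('i::{plus,one} \<Rightarrow> 'w \<Rightarrow> 's) \<Rightarrow> bool" where
  "stationary_process M N Z \<longleftrightarrow>
     (\<forall>n. Z n \<in> measurable M N) \<and> path_law M N (shift Z) = path_law M N Z"

definition ergodic_process ::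
    "'w measure \<Rightarrow> 's measure \<Rightarrow> ('i::{plus,one} \<Rightarrow> 'w \<Rightarrow> 's) \<Rightarrow> bool" where
  "ergodic_process M N Z \<longleftrightarrow>
     (\<forall>n. Z n \<in> measurable M N) \<and>
     (\<forall>E\<in>sets (path_space N). shift -` E \<inter> space (path_space N) = E \<longrightarrow>
        measure (path_law M N Z) E = 0 \<or> measure (path_law M N Z) E = 1)"

definition past_algebra :: "'w measure \<Rightarrow> 's measure \<Rightarrow> (int \<Rightarrow> 'w \<Rightarrow> 's) \<Rightarrow> int \<Rightarrow> 'w measure" where
  "past_algebra M N Z t =
     sigma (space M) {Z j -` E \<inter> space M | j E. j \<le> t \<and> E \<in> sets N}"

definition same_cond_law ::
    "'w measure \<Rightarrow> 'w measure \<Rightarrow> 's measure \<Rightarrow> ('w \<Rightarrow> 's) \<Rightarrow> ('w \<Rightarrow> 's) \<Rightarrow> bool" where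
  "same_cond_law M F N U V \<longleftrightarrow>
     (\<forall>E\<in>sets N. AE \<omega> in M.
        real_cond_exp M F (\<lambda>\<omega>. indicator E (U \<omega>)) \<omega> =
        real_cond_exp M F (\<lambda>\<omega>. indicator E (V \<omega>)) \<omega>)"

text \<open>
  The conditional expectation of a non-negative vector is taken with values in \<open>[0, \<infinity>]\<close>, since
  no integrability is assumed and \<open>real_cond_exp\<close> would send an infinite value to \<open>0\<close>.
\<close>

definition cond_mean ::
    "'w measure \<Rightarrow> 'w measure \<Rightarrow> ('w \<Rightarrow> nat ^ 'd) \<Rightarrow> 'w \<Rightarrow> ennreal ^ 'd" where
  "cond_mean M F U \<omega> = (\<chi> k. nn_cond_exp M F (\<lambda>\<omega>. of_nat (U \<omega> $ k)) \<omega>)"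

definition l1_norm_ennreal :: "ennreal ^ 'd \<Rightarrow> ennreal" where
  "l1_norm_ennreal x = (\<Sum>k\<in>UNIV. x $ k)"


text \<open>
  \<open>A n j i\<close> is the \<open>j\<close>-th offspring vector of an individual of type \<open>i\<close> at time \<open>n\<close>. Only \<open>j \<ge> 1\<close> is
  meaningful, and \<open>A n 0 i\<close> enters neither the environment \<open>Z\<^sub>n\<close> nor the recursion.
\<close>

definition env_space :: "((nat \<times> 'd \<Rightarrow> nat ^ 'd) \<times> (nat ^ 'd)) measure" where
  "env_space = PiM ({1..} \<times> UNIV) (\<lambda>_. count_space UNIV) \<Otimes>\<^sub>M count_space UNIV"

definition env ::
    "(int \<Rightarrow> nat \<Rightarrow> 'd \<Rightarrow> 'w \<Rightarrow> nat ^ 'd) \<Rightarrow> (int \<Rightarrow> 'w \<Rightarrow> nat ^ 'd) \<Rightarrow>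
     int \<Rightarrow> 'w \<Rightarrow> (nat \<times> 'd \<Rightarrow> nat ^ 'd) \<times> (nat ^ 'd)" where
  "env A B n \<omega> = ((\<lambda>(j, i)\<in>{1..} \<times> UNIV. A n j i \<omega>), B n \<omega>)"

primrec GW ::
    "(int \<Rightarrow> nat \<Rightarrow> 'd::finite \<Rightarrow> 'w \<Rightarrow> nat ^ 'd) \<Rightarrow> (int \<Rightarrow> 'w \<Rightarrow> nat ^ 'd) \<Rightarrow>
     ('w \<Rightarrow> nat ^ 'd) \<Rightarrow> nat \<Rightarrow> 'w \<Rightarrow> nat ^ 'd" where
  "GW A B V 0 = V"
| "GW A B V (Suc n) = (\<lambda>\<omega>.
     (\<Sum>i\<in>UNIV. \<Sum>j = 1..GW A B V n \<omega> $ i. A (int (Suc n)) j i \<omega>) + B (int (Suc n)) \<omega>)"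


text \<open>
  \<open>X V n\<close> is the state at time \<open>n\<close> of the process started from the random vector \<open>V\<close>. The
  predicate \<open>stable_start M X V\<close> says that \<open>V\<close> can serve as \<open>V\<^sup>*\<close> in the definition of strong
  stability.
\<close>

definition stable_start ::
    "'w measure \<Rightarrow> (('w \<Rightarrow> nat ^ 'd::finite) \<Rightarrow> nat \<Rightarrow> 'w \<Rightarrow> nat ^ 'd) \<Rightarrow> ('w \<Rightarrow> nat ^ 'd) \<Rightarrow> bool" where
  "stable_start M X Vs \<longleftrightarrow>
     Vs \<in> measurable M (count_space UNIV) \<and>
     stationary_process M (count_space UNIV) (X Vs) \<and>
     ergodic_process M (count_space UNIV) (X Vs) \<and>
     (\<forall>V\<in>measurable M (count_space UNIV).
        AE \<omega> in M. (\<lambda>n. real_vec (X V n \<omega>) - real_vec (X Vs n \<omega>)) \<longlonglongrightarrow> 0)"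

definition strongly_stable ::
    "'w measure \<Rightarrow> (('w \<Rightarrow> nat ^ 'd::finite) \<Rightarrow> nat \<Rightarrow> 'w \<Rightarrow> nat ^ 'd) \<Rightarrow> bool" where
  "strongly_stable M X \<longleftrightarrow> (\<exists>Vs. stable_start M X Vs)"

definition SLLN ::
    "'w measure \<Rightarrow> (('w \<Rightarrow> nat ^ 'd::finite) \<Rightarrow> nat \<Rightarrow> 'w \<Rightarrow> nat ^ 'd) \<Rightarrow> bool" where
  "SLLN M X \<longleftrightarrow> strongly_stable M X \<and>
     (\<forall>Vs. stable_start M X Vs \<longrightarrow>
        integrable M (\<lambda>\<omega>. real_vec (Vs \<omega>)) \<and>
        (\<forall>v. AE \<omega> in M.
           (\<lambda>n. (1 / real n) *\<^sub>R (\<Sum>i = 1..n. real_vec (X (\<lambda>_. v) i \<omega>)))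
             \<longlonglongrightarrow> (\<integral>\<omega>. real_vec (Vs \<omega>) \<partial>M)))"

end

theory Submission
  imports Defs
begin

text \<open>
  Started from \<open>0\<close> at time \<open>n - k\<close>, the state at time \<open>n\<close> is non-decreasing in \<open>k\<close> (Loynes), because
  offspring counts and immigration are non-negative. Conditionally on the past every individual
  has at most \<open>\<rho>\<close> children on average, so the expected population is bounded by
  \<open>E|B\<^sub>1| / (1 - \<rho>)\<close> uniformly in \<open>k\<close>, and the integer-valued limit is finite almost surely. It is a
  shift-equivariant function of the environment, hence a stationary ergodic process that obeys the
  recursion. Two copies started from deterministic vectors differ in mean by \<open>O(\<rho>\<^sup>n)\<close>, so almost surely
  they eventually coincide. A random start reduces to this because it takes only countably many
  values. The law of large numbers is Birkhoff's theorem for the stationary copy.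
\<close>

section \<open>The ergodic theorem\<close>

text \<open>No independence between individuals or between generations is assumed, so the whole
  contraction comes from one conditioning step. Two runs that are ordered at time 0 use the same
  offspring vectors for the individuals they share, and the surplus individual number j of type i is
  present exactly when j lies above one type-i count and not above the other. This event belongs to
  the past, so the conditional mean bound, which equality of the conditional laws extends to every
  j, applies to each surplus individual separately and gives the factor \<rho>. Stationarity carries
  the step from time 0 to all other times. A start that depends on the whole trajectory destroys
  this measurability. This is why the mean estimate is made only for deterministic starts, and why
  the exceptional null set is then chosen once for all of them. \<open>SLLN\<close> quantifies over
  every admissible stationary start, whose mean might a priori be infinite. The coupling forces each
  of them to have the law of the Loynes limit, which inherits the uniform mean bound.\<close>

locale mpt = prob_space P for P :: "'a measure" +
  fixes T :: "'a \<Rightarrow> 'a"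
  assumes T_measurable [measurable]: "T \<in> measurable P P"
    and T_invariant: "distr P P T = P"
begin

lemma integrable_comp_T:
  fixes f :: "'a \<Rightarrow> real"
  assumes "integrable P f"
  shows "integrable P (\<lambda>x. f (T x))"
proof -
  have "integrable (distr P P T) f" using assms by (simp add: T_invariant)
  then show ?thesis by (rule integrable_distr[OF T_measurable])
qed

lemma integral_comp_T:
  fixes f :: "'a \<Rightarrow> real"
  assumes [measurable]: "f \<in> borel_measurable P"
  shows "(\<integral>x. f (T x) \<partial>P) = (\<integral>x. f x \<partial>P)"
proof -
  have "(\<integral>x. f x \<partial>distr P P T) = (\<integral>x. f (T x) \<partial>P)"
    by (rule integral_distr) auto
  then show ?thesis by (simp add: T_invariant)
qed

definition birkhoff_sum :: "('a \<Rightarrow> real) \<Rightarrow> nat \<Rightarrow> 'a \<Rightarrow> real" where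
  "birkhoff_sum f n x = (\<Sum>i<n. f ((T ^^ i) x))"

lemma birkhoff_sum_Suc: "birkhoff_sum f (Suc n) x = f x + birkhoff_sum f n (T x)"
  unfolding birkhoff_sum_def by (subst sum.lessThan_Suc_shift) (simp add: funpow_swap1)

lemma birkhoff_sum_measurable [measurable]:
  assumes [measurable]: "f \<in> borel_measurable P"
  shows "birkhoff_sum f n \<in> borel_measurable P"
proof (induction n)
  case 0
  then show ?case by (simp add: birkhoff_sum_def[abs_def])
next
  case (Suc n)
  note [measurable] = Suc
  have "birkhoff_sum f (Suc n) = (\<lambda>x. f x + birkhoff_sum f n (T x))"
    by (auto simp: birkhoff_sum_Suc)
  then show ?case by simp
qed

text \<open>\<open>birkhoff_max g N\<close> is the maximum of the Birkhoff sums of order at most \<open>N\<close>.\<close>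

primrec birkhoff_max :: "('a \<Rightarrow> real) \<Rightarrow> nat \<Rightarrow> 'a \<Rightarrow> real" where
  "birkhoff_max g 0 x = 0"
| "birkhoff_max g (Suc N) x = max 0 (g x + birkhoff_max g N (T x))"

lemma birkhoff_max_nonneg: "0 \<le> birkhoff_max g N x"
  by (cases N) auto

lemma birkhoff_max_mono: "birkhoff_max g N x \<le> birkhoff_max g (Suc N) x"
proof (induction N arbitrary: x)
  case (Suc N)
  have "birkhoff_max g N (T x) \<le> birkhoff_max g (Suc N) (T x)" by (rule Suc)
  then show ?case by (simp del: birkhoff_max.simps(2) add: birkhoff_max.simps(2)[of g N x] birkhoff_max.simps(2)[of g "Suc N" x])
qed simp

lemma birkhoff_sum_le_max: "birkhoff_sum g N x \<le> birkhoff_max g N x"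
proof (induction N arbitrary: x)
  case 0
  then show ?case by (simp add: birkhoff_sum_def)
next
  case (Suc N)
  show ?case using Suc[of "T x"] by (simp add: birkhoff_sum_Suc)
qed

lemma birkhoff_max_integrable:
  assumes "integrable P g"
  shows "integrable P (birkhoff_max g N)"
proof (induction N)
  case 0
  have "birkhoff_max g 0 = (\<lambda>x. 0)" by auto
  then show ?case by simp
next
  case (Suc N)
  have "birkhoff_max g (Suc N) = (\<lambda>x. max 0 (g x + birkhoff_max g N (T x)))"
    by auto
  then show ?case using assms integrable_comp_T[OF Suc] by simp
qed

text \<open>Garsia's argument. Where the maximum \<open>birkhoff_max g (Suc N)\<close> is positive
  at x, it equals g x plus the maximum of order N at T x; elsewhere it is 0, which is at most its
  value at T x. So its decrease from x to T x is at most \<open>?G N x\<close>, and by invariance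
  this decrease has integral 0.\<close>

theorem maximal_ergodic:
  assumes g: "integrable P g"
    and pos: "AE x in P. \<exists>n. birkhoff_sum g n x > 0"
  shows "0 \<le> (\<integral>x. g x \<partial>P)"
proof -
  have [measurable]: "g \<in> borel_measurable P" using g by auto
  have [measurable]: "birkhoff_max g N \<in> borel_measurable P" for N
    using birkhoff_max_integrable[OF g, of N] by auto
  let ?G = "\<lambda>N x. g x * indicator {x. 0 < birkhoff_max g (Suc N) x} x"
  have bound: "norm (?G N x) \<le> \<bar>g x\<bar>" for N x
    by (auto simp: indicator_def)
  have [measurable]: "?G N \<in> borel_measurable P" for N
  proof -
    have "?G N = (\<lambda>x. if 0 < birkhoff_max g (Suc N) x then g x else 0)"
      by (auto simp: fun_eq_iff indicator_def)
    then show ?thesis by (simp del: birkhoff_max.simps(2))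
  qed
  have G_int: "integrable P (?G N)" for N
    by (rule Bochner_Integration.integrable_bound[OF g]) (use bound in auto)
  have "0 \<le> (\<integral>x. ?G N x \<partial>P)" for N
  proof -
    note M_int = birkhoff_max_integrable[OF g, of "Suc N"]
    have "birkhoff_max g (Suc N) x - birkhoff_max g (Suc N) (T x) \<le> ?G N x" for x
      using birkhoff_max_mono[of g N "T x"] birkhoff_max_nonneg[of g "Suc N" "T x"]
      by (auto simp: indicator_def birkhoff_max.simps(2)[of g N x] simp del: birkhoff_max.simps(2))
    then have "(\<integral>x. birkhoff_max g (Suc N) x - birkhoff_max g (Suc N) (T x) \<partial>P) \<le> (\<integral>x. ?G N x \<partial>P)"
      by (intro integral_mono G_int Bochner_Integration.integrable_diff M_int integrable_comp_T)
    moreover have "(\<integral>x. birkhoff_max g (Suc N) x - birkhoff_max g (Suc N) (T x) \<partial>P) = 0"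
      by (subst Bochner_Integration.integral_diff[OF M_int integrable_comp_T[OF M_int]])
        (subst integral_comp_T, auto)
    ultimately show ?thesis by simp
  qed
  moreover have "(\<lambda>N. \<integral>x. ?G N x \<partial>P) \<longlonglongrightarrow> (\<integral>x. g x \<partial>P)"
  proof (rule integral_dominated_convergence[where w = "\<lambda>x. \<bar>g x\<bar>"])
    \<comment> \<open>Once one Birkhoff sum at x is positive, the maxima of all larger orders are
      positive too, so the indicator is eventually 1.\<close>
    show "AE x in P. (\<lambda>N. ?G N x) \<longlonglongrightarrow> g x"
      using pos
    proof eventually_elim
      case (elim x)
      then obtain n where "birkhoff_sum g n x > 0" by auto
      then have n: "birkhoff_max g n x > 0" using birkhoff_sum_le_max[of g n x] by simp
      have "birkhoff_max g N x > 0" if "N \<ge> n" for N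
        using that by (induction N rule: dec_induct)
          (use n birkhoff_max_mono[of g _ x] in \<open>auto intro: less_le_trans simp del: birkhoff_max.simps(2)\<close>)
      then have "\<forall>\<^sub>F N in sequentially. ?G N x = g x"
        by (intro eventually_sequentiallyI[of n]) (auto simp: indicator_def simp del: birkhoff_max.simps(2))
      then show ?case by (simp add: tendsto_eventually)
    qed
  qed (use g bound in auto)
  ultimately show ?thesis by (intro LIMSEQ_le_const) auto
qed

end

locale ergodic_mpt = mpt +
  assumes ergodic: "E \<in> sets P \<Longrightarrow> T -` E \<inter> space P = E \<Longrightarrow> measure P E = 0 \<or> measure P E = 1"
begin

text \<open>Subtracting a makes the mean negative. Unboundedness of the Birkhoff sums is an exactly
  invariant event, because the sums at x and at T x differ by the single finite term
  \<open>?g x\<close>. If it had probability 1, the maximal theorem would make the mean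
  non-negative.\<close>

lemma birkhoff_sum_bdd_above:
  assumes f: "integrable P f" and a: "(\<integral>x. f x \<partial>P) < a"
  shows "AE x in P. bdd_above (range (\<lambda>n. birkhoff_sum f n x - real n * a))"
proof -
  have [measurable]: "f \<in> borel_measurable P" using f by auto
  let ?g = "\<lambda>x. f x - a"
  have sum_g: "birkhoff_sum ?g n x = birkhoff_sum f n x - real n * a" for n x
    by (simp add: birkhoff_sum_def sum_subtractf)
  define E where "E = {x \<in> space P. \<forall>k::nat. \<exists>n. birkhoff_sum ?g n x > real k}"
  have E_iff: "x \<in> E \<longleftrightarrow> x \<in> space P \<and> \<not> bdd_above (range (\<lambda>n. birkhoff_sum ?g n x))" for x
    unfolding E_def bdd_above_def
    by (auto simp: not_le) (meson reals_Archimedean2 order.strict_trans less_le_not_le not_le order_le_less_trans)+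
  have [measurable]: "E \<in> sets P" unfolding E_def by measurable
  have inv: "bdd_above (range (\<lambda>n. birkhoff_sum ?g n (T x))) \<longleftrightarrow> bdd_above (range (\<lambda>n. birkhoff_sum ?g n x))" for x
  proof -
    have S: "birkhoff_sum ?g n (T x) = birkhoff_sum ?g (Suc n) x - ?g x" for n
      by (simp add: birkhoff_sum_Suc)
    show ?thesis
    proof
      assume "bdd_above (range (\<lambda>n. birkhoff_sum ?g n (T x)))"
      then obtain c where c: "birkhoff_sum ?g n (T x) \<le> c" for n
        by (auto simp: bdd_above_def)
      \<comment> \<open>The 0 accounts for the empty sum at n = 0.\<close>
      have "birkhoff_sum ?g n x \<le> max 0 (?g x + c)" for n
        using c[of "n - 1"] by (cases n) (auto simp: birkhoff_sum_Suc birkhoff_sum_def[of _ 0] max_def)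
      then show "bdd_above (range (\<lambda>n. birkhoff_sum ?g n x))" by (rule bdd_aboveI2)
    next
      assume "bdd_above (range (\<lambda>n. birkhoff_sum ?g n x))"
      then obtain c where c: "birkhoff_sum ?g n x \<le> c" for n
        by (auto simp: bdd_above_def)
      have "birkhoff_sum ?g n (T x) \<le> c - ?g x" for n
        using c[of "Suc n"] by (simp add: birkhoff_sum_Suc)
      then show "bdd_above (range (\<lambda>n. birkhoff_sum ?g n (T x)))" by (rule bdd_aboveI2)
    qed
  qed
  have "T -` E \<inter> space P = E"
    using measurable_space[OF T_measurable] by (auto simp: E_iff inv)
  then consider "measure P E = 0" | "measure P E = 1" using ergodic[of E] by auto
  then show ?thesis
  proof cases
    case 1
    then have "AE x in P. x \<notin> E" by (simp add: prob_eq_0)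
    then show ?thesis by (rule AE_mp) (auto intro!: AE_I2 simp: E_iff sum_g)
  next
    case 2
    then have "AE x in P. x \<in> E" by (simp add: prob_eq_1)
    then have "AE x in P. \<exists>n. birkhoff_sum ?g n x > 0"
      by (rule AE_mp) (intro AE_I2 impI, simp add: E_def, metis of_nat_0)
    then have "0 \<le> (\<integral>x. ?g x \<partial>P)" using f by (intro maximal_ergodic) auto
    with f a show ?thesis by (simp add: prob_space)
  qed
qed

lemma birkhoff_eventually_less:
  assumes f: "integrable P f" and e: "e > 0"
  shows "AE x in P. \<forall>\<^sub>F n in sequentially. birkhoff_sum f n x / real n < (\<integral>x. f x \<partial>P) + e"
proof -
  \<comment> \<open>Half of e makes the centred sums bounded by some c; the other half, multiplied
    by n, eventually exceeds c.\<close>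
  let ?a = "(\<integral>x. f x \<partial>P) + e / 2"
  have "AE x in P. bdd_above (range (\<lambda>n. birkhoff_sum f n x - real n * ?a))"
    using e by (intro birkhoff_sum_bdd_above f) auto
  then show ?thesis
  proof eventually_elim
    case (elim x)
    then obtain c where c: "birkhoff_sum f n x - real n * ?a \<le> c" for n
      by (auto simp: bdd_above_def)
    have "\<forall>\<^sub>F n in sequentially. real n > 2 * c / e"
      by (rule eventually_compose_filterlim[OF eventually_gt_at_top filterlim_real_sequentially])
    moreover have "\<forall>\<^sub>F n in sequentially. n > (0::nat)" by (rule eventually_gt_at_top)
    ultimately show ?case
    proof eventually_elim
      case (elim n)
      then have "c < real n * (e / 2)" using e by (simp add: field_simps)
      with c[of n] have "birkhoff_sum f n x < real n * ((\<integral>x. f x \<partial>P) + e)"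
        by (simp add: algebra_simps)
      with elim show ?case by (simp add: field_simps)
    qed
  qed
qed

text \<open>The one-sided bound for f and for -f, along the countably many margins 1/(k+1), gives
  both halves of the limit outside one null set.\<close>

theorem birkhoff_ergodic:
  assumes f: "integrable P f"
  shows "AE x in P. (\<lambda>n. birkhoff_sum f n x / real n) \<longlonglongrightarrow> (\<integral>x. f x \<partial>P)"
proof -
  have neg: "birkhoff_sum (\<lambda>x. - f x) n x = - birkhoff_sum f n x" for n x
    by (simp add: birkhoff_sum_def sum_negf)
  have "AE x in P. \<forall>k. \<forall>\<^sub>F n in sequentially. birkhoff_sum f n x / real n < (\<integral>x. f x \<partial>P) + 1 / real (Suc k)"
    using birkhoff_eventually_less[OF f] by (subst AE_all_countable) auto
  moreover have "AE x in P. \<forall>k. \<forall>\<^sub>F n in sequentially. birkhoff_sum (\<lambda>x. - f x) n x / real n < (\<integral>x. - f x \<partial>P) + 1 / real (Suc k)"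
    using birkhoff_eventually_less[of "\<lambda>x. - f x"] f by (subst AE_all_countable) auto
  ultimately show ?thesis
  proof eventually_elim
    case (elim x)
    show ?case
    proof (rule tendstoI)
      fix e :: real assume "e > 0"
      then obtain k where k: "1 / real (Suc k) < e" using nat_approx_posE by blast
      show "\<forall>\<^sub>F n in sequentially. dist (birkhoff_sum f n x / real n) (\<integral>x. f x \<partial>P) < e"
        using elim(1)[rule_format, of k] elim(2)[rule_format, of k]
        by eventually_elim (use k in \<open>auto simp: dist_real_def abs_less_iff neg\<close>)
    qed
  qed
qed

end

section \<open>Stationary and ergodic processes\<close>

lemma shift_measurable [measurable]: "shift \<in> measurable (path_space N) (path_space N)"
  unfolding shift_def[abs_def] path_space_def
  by (rule measurable_PiM_single') (auto simp: space_PiM)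

lemma path_measurable:
  assumes "\<And>n. Z n \<in> measurable M N"
  shows "(\<lambda>\<omega> n. Z n \<omega>) \<in> measurable M (path_space N)"
  unfolding path_space_def
  by (rule measurable_PiM_single') (use assms in \<open>auto dest: measurable_space\<close>)

lemma coordinate_measurable: "(\<lambda>z. z n) \<in> measurable (path_space N) N"
  unfolding path_space_def by simp

lemma (in prob_space) path_law_shift:
  assumes "stationary_process M N Z"
  shows "distr (path_law M N Z) (path_law M N Z) shift = path_law M N Z"
proof -
  have Z: "\<And>n. Z n \<in> measurable M N" and law: "path_law M N (shift Z) = path_law M N Z"
    using assms by (auto simp: stationary_process_def)
  note [measurable] = path_measurable[OF Z]
  have "distr (path_law M N Z) (path_law M N Z) shift = distr (path_law M N Z) (path_space N) shift"
    by (rule distr_cong) (auto simp: path_law_def)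
  also have "\<dots> = distr M (path_space N) (\<lambda>\<omega>. shift (\<lambda>n. Z n \<omega>))"
    unfolding path_law_def by (subst distr_distr) (auto simp: comp_def)
  also have "\<dots> = path_law M N (shift Z)"
    by (simp add: path_law_def shift_def)
  finally show ?thesis by (simp add: law)
qed

lemma (in prob_space) birkhoff_process:
  fixes X :: "nat \<Rightarrow> 'a \<Rightarrow> 's" and f :: "'s \<Rightarrow> real"
  assumes stat: "stationary_process M N X" and erg: "ergodic_process M N X"
    and [measurable]: "f \<in> borel_measurable N" and int: "integrable M (\<lambda>\<omega>. f (X 0 \<omega>))"
  shows "AE \<omega> in M. (\<lambda>n. (\<Sum>i<n. f (X i \<omega>)) / real n) \<longlonglongrightarrow> (\<integral>\<omega>. f (X 0 \<omega>) \<partial>M)"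
proof -
  have X: "\<And>n. X n \<in> measurable M N"
    using stat by (auto simp: stationary_process_def)
  note [measurable] = path_measurable[OF X] coordinate_measurable[of _ N]
  let ?P = "path_law M N X"
  have sets_P [measurable_cong]: "sets ?P = sets (path_space N)" by (simp add: path_law_def)
  interpret P: ergodic_mpt ?P shift
  proof (intro ergodic_mpt.intro mpt.intro mpt_axioms.intro ergodic_mpt_axioms.intro)
    show "prob_space ?P" unfolding path_law_def by (rule prob_space_distr) simp
    show "shift \<in> measurable ?P ?P" by measurable
    show "distr ?P ?P shift = ?P" by (rule path_law_shift[OF stat])
    fix E assume "E \<in> sets ?P" "shift -` E \<inter> space ?P = E"
    with erg show "measure ?P E = 0 \<or> measure ?P E = 1"
      by (simp add: ergodic_process_def path_law_def)
  qed
  have f_int: "integrable ?P (\<lambda>x. f (x 0))"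
    unfolding path_law_def using int by (subst integrable_distr_eq) auto
  have f_eq: "(\<integral>x. f (x 0) \<partial>?P) = (\<integral>\<omega>. f (X 0 \<omega>) \<partial>M)"
    unfolding path_law_def by (subst integral_distr) auto
  have pow: "(shift ^^ i) x = (\<lambda>n. x (n + i))" for i :: nat and x :: "nat \<Rightarrow> 's"
    by (induction i arbitrary: x) (auto simp: shift_def)
  have "AE x in ?P. (\<lambda>n. (\<Sum>i<n. f (x i)) / real n) \<longlonglongrightarrow> (\<integral>\<omega>. f (X 0 \<omega>) \<partial>M)"
    using P.birkhoff_ergodic[OF f_int] by (simp add: P.birkhoff_sum_def pow f_eq)
  then show ?thesis unfolding path_law_def by (rule AE_distrD[rotated]) simp
qed

text \<open>An invariant event of the image pulls back along an equivariant map to an invariant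
  event of the source. The two index types are independent, so a two-sided environment may drive a
  one-sided process.\<close>

lemma stationary_ergodic_factor:
  fixes \<Phi> :: "('i::{plus,one} \<Rightarrow> 's) \<Rightarrow> ('j::{plus,one} \<Rightarrow> 't)"
  assumes stat: "stationary_process M N Z" and erg: "ergodic_process M N Z"
    and [measurable]: "\<Phi> \<in> measurable (path_space N) (path_space N')"
    and equiv: "\<And>z. \<Phi> (shift z) = shift (\<Phi> z)"
  defines "Y \<equiv> \<lambda>n \<omega>. \<Phi> (\<lambda>m. Z m \<omega>) n"
  shows "stationary_process M N' Y" "ergodic_process M N' Y"
proof -
  have Z: "\<And>n. Z n \<in> measurable M N" and law: "path_law M N (shift Z) = path_law M N Z"
    using stat by (auto simp: stationary_process_def)
  note [measurable] = path_measurable[OF Z] coordinate_measurable[of _ N']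
  have [measurable]: "(\<lambda>\<omega> m. shift Z m \<omega>) \<in> measurable M (path_space N)"
    by (rule path_measurable) (simp add: shift_def Z)
  have Y [measurable]: "Y n \<in> measurable M N'" for n unfolding Y_def by measurable
  have lawY: "path_law M N' Y = distr (path_law M N Z) (path_space N') \<Phi>"
    unfolding path_law_def Y_def by (subst distr_distr) (auto simp: comp_def)
  have "(\<lambda>m. shift Z m \<omega>) = shift (\<lambda>m. Z m \<omega>)" for \<omega> by (simp add: shift_def)
  then have shift_Y: "(\<lambda>n. shift Y n \<omega>) = \<Phi> (\<lambda>m. shift Z m \<omega>)" for \<omega>
    by (simp only: equiv) (simp add: shift_def Y_def)
  have "path_law M N' (shift Y) = distr (path_law M N (shift Z)) (path_space N') \<Phi>"
    unfolding path_law_def shift_Y by (subst distr_distr) (auto simp: comp_def)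
  with Y show "stationary_process M N' Y"
    by (simp add: stationary_process_def law lawY)
  show "ergodic_process M N' Y"
    unfolding ergodic_process_def
  proof (intro conjI allI ballI impI Y)
    fix E :: "('j \<Rightarrow> 't) set"
    assume [measurable]: "E \<in> sets (path_space N')" and inv: "shift -` E \<inter> space (path_space N') = E"
    let ?E = "\<Phi> -` E \<inter> space (path_space N)"
    have [measurable]: "?E \<in> sets (path_space N)" by measurable
    have "\<Phi> z \<in> E \<longleftrightarrow> shift (\<Phi> z) \<in> E" if "z \<in> space (path_space N)" for z
      using inv measurable_space[OF \<open>\<Phi> \<in> measurable (path_space N) (path_space N')\<close> that]
      by blast
    then have "shift -` ?E \<inter> space (path_space N) = ?E"
      using measurable_space[OF shift_measurable[of N]] by (auto simp: equiv)
    then have "measure (path_law M N Z) ?E = 0 \<or> measure (path_law M N Z) ?E = 1"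
      using erg unfolding ergodic_process_def by (metis \<open>?E \<in> sets (path_space N)\<close>)
    moreover have "measure (path_law M N' Y) E = measure (path_law M N Z) ?E"
      unfolding lawY by (subst measure_distr) (auto simp: path_law_def)
    ultimately show "measure (path_law M N' Y) E = 0 \<or> measure (path_law M N' Y) E = 1"
      by simp
  qed
qed

text \<open>Apart from measurability, both properties depend only on the path law. The lemma is
  needed because the Loynes limit satisfies the recursion only almost surely.\<close>

lemma stationary_ergodic_cong_AE:
  assumes stat: "stationary_process M N Y" and erg: "ergodic_process M N Y"
    and X: "\<And>n. X n \<in> measurable M N" and eq: "AE \<omega> in M. \<forall>n. X n \<omega> = Y n \<omega>"
  shows "stationary_process M N X" "ergodic_process M N X"
proof -
  have Y: "\<And>n. Y n \<in> measurable M N"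
    using stat by (auto simp: stationary_process_def)
  have law: "path_law M N X = path_law M N Y"
    unfolding path_law_def
    by (rule distr_cong_AE[OF refl refl _ path_measurable[OF X] path_measurable[OF Y]])
      (use eq in \<open>auto simp: fun_eq_iff\<close>)
  have law_shift: "path_law M N (shift X) = path_law M N (shift Y)"
    unfolding path_law_def
    by (rule distr_cong_AE[OF refl refl _ path_measurable path_measurable])
      (use eq X Y in \<open>auto simp: fun_eq_iff shift_def\<close>)
  show "stationary_process M N X" "ergodic_process M N X"
    using stat erg X by (auto simp: stationary_process_def ergodic_process_def law law_shift)
qed

lemma (in prob_space) nn_integral_shift:
  assumes stat: "stationary_process M N Z"
    and [measurable]: "h \<in> borel_measurable (path_space N)"
  shows "(\<integral>\<^sup>+\<omega>. h (shift (\<lambda>n. Z n \<omega>)) \<partial>M) = (\<integral>\<^sup>+\<omega>. h (\<lambda>n. Z n \<omega>) \<partial>M)"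
proof -
  have Z: "\<And>n. Z n \<in> measurable M N"
    using stat by (auto simp: stationary_process_def)
  note [measurable] = path_measurable[OF Z]
  have [measurable]: "h \<in> borel_measurable (path_law M N Z)"
    "shift \<in> measurable (path_law M N Z) (path_law M N Z)"
    by (simp_all add: path_law_def)
  have "(\<integral>\<^sup>+z. h z \<partial>path_law M N Z) = (\<integral>\<^sup>+z. h (shift z) \<partial>path_law M N Z)"
    by (subst (1) path_law_shift[OF stat, symmetric], subst nn_integral_distr) auto
  then show ?thesis
    by (simp add: path_law_def nn_integral_distr)
qed

lemma stationary_process_distr:
  fixes X :: "nat \<Rightarrow> 'w \<Rightarrow> 's"
  assumes "stationary_process M N X"
  shows "distr M N (X n) = distr M N (X 0)"
proof (induction n)
  case (Suc n)
  have X: "\<And>n. X n \<in> measurable M N" and law: "path_law M N (shift X) = path_law M N X"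
    using assms by (auto simp: stationary_process_def)
  have marginal: "distr (path_law M N Y) N (\<lambda>z. z n) = distr M N (Y n)"
    if "\<And>n. Y n \<in> measurable M N" for Y :: "nat \<Rightarrow> 'w \<Rightarrow> 's"
    unfolding path_law_def
    by (subst distr_distr[OF coordinate_measurable path_measurable[OF that]]) (simp add: comp_def)
  have "distr M N (X (Suc n)) = distr M N (shift X n)" by (simp add: shift_def)
  also have "\<dots> = distr M N (X n)"
    using marginal[of "shift X"] marginal[of X] X by (simp add: law) (simp add: shift_def)
  finally show ?case using Suc by simp
qed simp

section \<open>Conditioning on the past\<close>

lemma past_algebra_measurable:
  assumes "\<And>n. Z n \<in> measurable M N"
  shows "subalgebra M (past_algebra M N Z t)"
    and "m \<le> t \<Longrightarrow> Z m \<in> measurable (past_algebra M N Z t) N"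
proof -
  let ?G = "{Z j -` E \<inter> space M | j E. j \<le> t \<and> E \<in> sets N}"
  have G: "?G \<subseteq> sets M" using assms by (auto intro: measurable_sets)
  then have Pow: "?G \<subseteq> Pow (space M)" using sets.sets_into_space by blast
  show "subalgebra M (past_algebra M N Z t)"
    unfolding past_algebra_def subalgebra_def
    using G by (simp add: sets_measure_of[OF Pow] sets.sigma_sets_subset space_measure_of[OF Pow])
  show "Z m \<in> measurable (past_algebra M N Z t) N" if "m \<le> t"
  proof (rule measurableI)
    show "Z m x \<in> space N" if "x \<in> space (past_algebra M N Z t)" for x
      using that measurable_space[OF assms] by (simp add: past_algebra_def space_measure_of[OF Pow])
    show "Z m -` E \<inter> space (past_algebra M N Z t) \<in> sets (past_algebra M N Z t)" if "E \<in> sets N" for E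
      using that \<open>m \<le> t\<close>
      by (auto simp: past_algebra_def space_measure_of[OF Pow] sets_measure_of[OF Pow] intro!: sigma_sets.Basic)
  qed
qed

text \<open>The l1 norm of a state, kept in \<open>nat\<close> so that a difference below 1 is
  already 0.\<close>

definition total :: "nat ^ 'd \<Rightarrow> nat" where
  "total x = (\<Sum>k\<in>UNIV. x $ k)"

text \<open>Restricting M to G and pushing forward along U or V gives the same measure, since the
  two images agree on every E by the defining property of conditional expectation. Comparing
  measures rather than expectations covers functions f with infinite integral, such as offspring
  counts before any moment bound is known.\<close>

lemma same_cond_law_nn_integral:
  fixes U V :: "'w \<Rightarrow> 's" and f :: "'s \<Rightarrow> ennreal"
  assumes "prob_space M" and sub: "subalgebra M F"
    and [measurable]: "U \<in> measurable M N" "V \<in> measurable M N" "f \<in> borel_measurable N"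
    and law: "same_cond_law M F N U V" and G: "G \<in> sets F"
  shows "(\<integral>\<^sup>+\<omega>. f (U \<omega>) * indicator G \<omega> \<partial>M) = (\<integral>\<^sup>+\<omega>. f (V \<omega>) * indicator G \<omega> \<partial>M)"
proof -
  interpret prob_space M by fact
  interpret finite_measure_subalgebra M F by unfold_locales (rule sub)
  have [measurable]: "G \<in> sets M" using G sub by (auto simp: subalgebra_def)
  have emeasure_eq: "emeasure (distr (density M (indicator G)) N W) E =
      ennreal (\<integral>\<omega>\<in>G. indicator E (W \<omega>) \<partial>M)"
    if [measurable]: "W \<in> measurable M N" "E \<in> sets N" for W E
  proof -
    have "emeasure (distr (density M (indicator G)) N W) E = (\<integral>\<^sup>+\<omega>. indicator G \<omega> * indicator E (W \<omega>) \<partial>M)"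
      by (subst emeasure_distr)
        (auto simp: emeasure_density indicator_def intro!: nn_integral_cong)
    also have "\<dots> = (\<integral>\<^sup>+\<omega>. ennreal (indicator G \<omega> * indicator E (W \<omega>)) \<partial>M)"
      by (intro nn_integral_cong) (auto simp: indicator_def)
    also have "\<dots> = ennreal (\<integral>\<omega>. indicator G \<omega> * indicator E (W \<omega>) \<partial>M)"
      by (intro nn_integral_eq_integral integrable_const_bound[where B = 1] AE_I2)
        (auto simp: indicator_def)
    finally show ?thesis by (simp add: set_lebesgue_integral_def)
  qed
  have "distr (density M (indicator G)) N U = distr (density M (indicator G)) N V"
  proof (rule measure_eqI)
    fix E assume "E \<in> sets (distr (density M (indicator G)) N U)"
    then have E [measurable]: "E \<in> sets N" by simp
    have int: "integrable M (\<lambda>\<omega>. indicator E (W \<omega>) :: real)" if [measurable]: "W \<in> measurable M N" for W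
      by (intro integrable_const_bound[where B = 1] AE_I2) (auto simp: indicator_def)
    have "(\<integral>\<omega>\<in>G. indicator E (U \<omega>) \<partial>M) = (\<integral>\<omega>\<in>G. real_cond_exp M F (\<lambda>\<omega>. indicator E (U \<omega>)) \<omega> \<partial>M)"
      by (rule real_cond_exp_intA) (use int G in auto)
    also have "\<dots> = (\<integral>\<omega>\<in>G. real_cond_exp M F (\<lambda>\<omega>. indicator E (V \<omega>)) \<omega> \<partial>M)"
      unfolding set_lebesgue_integral_def
      using law E unfolding same_cond_law_def by (intro integral_cong_AE) auto
    also have "\<dots> = (\<integral>\<omega>\<in>G. indicator E (V \<omega>) \<partial>M)"
      by (rule real_cond_exp_intA[symmetric]) (use int G in auto)
    finally show "emeasure (distr (density M (indicator G)) N U) E = emeasure (distr (density M (indicator G)) N V) E"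
      by (simp add: emeasure_eq)
  qed simp
  then have "(\<integral>\<^sup>+x. f x \<partial>distr (density M (indicator G)) N U) = (\<integral>\<^sup>+x. f x \<partial>distr (density M (indicator G)) N V)"
    by simp
  then show ?thesis
    by (simp add: nn_integral_distr nn_integral_density mult.commute)
qed

lemma nn_integral_cond_mean_bound:
  fixes V :: "'w \<Rightarrow> nat ^ 'd::finite"
  assumes "prob_space M" and sub: "subalgebra M F"
    and [measurable]: "V \<in> measurable M (count_space UNIV)"
    and bound: "AE \<omega> in M. l1_norm_ennreal (cond_mean M F V \<omega>) \<le> r" and G: "G \<in> sets F"
  shows "(\<integral>\<^sup>+\<omega>. of_nat (total (V \<omega>)) * indicator G \<omega> \<partial>M) \<le> r * emeasure M G"
proof -
  interpret prob_space M by fact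
  interpret finite_measure_subalgebra M F by unfold_locales (rule sub)
  have [measurable]: "G \<in> sets M" using G sub by (auto simp: subalgebra_def)
  have ind: "(indicator G :: 'w \<Rightarrow> ennreal) \<in> borel_measurable F" using G by simp
  have "(\<integral>\<^sup>+\<omega>. of_nat (total (V \<omega>)) * indicator G \<omega> \<partial>M)
      = (\<integral>\<^sup>+\<omega>. (\<Sum>k\<in>UNIV. indicator G \<omega> * of_nat (V \<omega> $ k)) \<partial>M)"
    by (simp add: total_def sum_distrib_left mult.commute)
  also have "\<dots> = (\<Sum>k\<in>UNIV. \<integral>\<^sup>+\<omega>. indicator G \<omega> * of_nat (V \<omega> $ k) \<partial>M)"
    by (rule nn_integral_sum) simp
  also have "\<dots> = (\<Sum>k\<in>UNIV. \<integral>\<^sup>+\<omega>. indicator G \<omega> * nn_cond_exp M F (\<lambda>\<omega>. of_nat (V \<omega> $ k)) \<omega> \<partial>M)"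
    by (intro sum.cong refl nn_cond_exp_intg[symmetric] ind) simp
  also have "\<dots> = (\<integral>\<^sup>+\<omega>. (\<Sum>k\<in>UNIV. indicator G \<omega> * nn_cond_exp M F (\<lambda>\<omega>. of_nat (V \<omega> $ k)) \<omega>) \<partial>M)"
    by (rule nn_integral_sum[symmetric]) simp
  also have "\<dots> = (\<integral>\<^sup>+\<omega>. indicator G \<omega> * l1_norm_ennreal (cond_mean M F V \<omega>) \<partial>M)"
    by (simp add: l1_norm_ennreal_def cond_mean_def sum_distrib_left)
  also have "\<dots> \<le> (\<integral>\<^sup>+\<omega>. r * indicator G \<omega> \<partial>M)"
  proof (rule nn_integral_mono_AE)
    show "AE \<omega> in M. indicator G \<omega> * l1_norm_ennreal (cond_mean M F V \<omega>) \<le> r * indicator G \<omega>"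
      using bound by eventually_elim (auto simp: indicator_def)
  qed
  also have "\<dots> = r * emeasure M G"
    by (simp add: nn_integral_cmult)
  finally show ?thesis .
qed

section \<open>The branching recursion\<close>

type_synonym 'd environment = "(nat \<times> 'd \<Rightarrow> nat ^ 'd) \<times> (nat ^ 'd)"

definition gw_step :: "'d::finite environment \<Rightarrow> nat ^ 'd \<Rightarrow> nat ^ 'd" where
  "gw_step e x = (\<Sum>i\<in>UNIV. \<Sum>j = 1..x $ i. fst e (j, i)) + snd e"

text \<open>\<open>gw_from v k n z\<close> is the state at time \<open>n\<close> of the process started from \<open>v\<close> at time \<open>n - k\<close>.\<close>

primrec gw_from :: "nat ^ 'd \<Rightarrow> nat \<Rightarrow> int \<Rightarrow> (int \<Rightarrow> 'd::finite environment) \<Rightarrow> nat ^ 'd" where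
  "gw_from v 0 n z = v"
| "gw_from v (Suc k) n z = gw_step (z n) (gw_from v k (n - 1) z)"

text \<open>On paths without an eventual value the result is unspecified, but the predicate under
  \<open>THE\<close> still commutes with the shift. Equivariance therefore holds on every path, as
  \<open>stationary_ergodic_factor\<close> requires.\<close>

definition gw_limit :: "int \<Rightarrow> (int \<Rightarrow> 'd::finite environment) \<Rightarrow> nat ^ 'd" where
  "gw_limit n z = (THE x. \<forall>\<^sub>F k in sequentially. gw_from 0 k n z = x)"

lemma total_add: "total (x + y) = total x + total y"
  by (simp add: total_def sum.distrib)

lemma total_0 [simp]: "total 0 = 0"
  by (simp add: total_def)

lemma total_sum: "total (\<Sum>i\<in>I. f i) = (\<Sum>i\<in>I. total (f i))"
  by (simp add: total_def sum.swap[of _ UNIV I])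

lemma total_mono: "x \<le> y \<Longrightarrow> total x \<le> total y"
  by (auto simp: total_def less_eq_vec_def intro: sum_mono)

lemma component_le_total: "x $ k \<le> total x"
  unfolding total_def by (rule member_le_sum) auto

text \<open>Turns equality of ordered states into one inequality between integers; both the Loynes
  limit and the coupling conclude with it.\<close>

lemma eq_if_le_total_le:
  assumes "x \<le> y" "total y \<le> total x"
  shows "x = y"
proof (rule ccontr)
  assume "x \<noteq> y"
  then obtain k where "x $ k < y $ k"
    using assms(1) by (metis less_eq_vec_def vec_eq_iff le_neq_implies_less)
  then have "total x < total y"
    using assms(1) unfolding total_def by (intro sum_strict_mono_ex1) (auto simp: less_eq_vec_def)
  with assms(2) show False by simp
qed

lemma gw_step_0 [simp]: "gw_step e 0 = snd e"
  by (simp add: gw_step_def)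

lemma gw_step_mono:
  assumes "x \<le> y"
  shows "gw_step e x \<le> gw_step e y"
  unfolding gw_step_def less_eq_vec_def
  using order_trans[OF _ assms[unfolded less_eq_vec_def, rule_format]]
  by (auto intro!: sum_mono sum_mono2)

text \<open>Individuals numbered up to \<open>p $ i\<close> exist in both populations and have the
  same children, and the immigrants coincide. Only the surplus individuals contribute to the
  difference.\<close>

lemma total_gw_step:
  assumes "p \<le> q"
  shows "total (gw_step e q) =
    total (gw_step e p) + (\<Sum>i\<in>UNIV. \<Sum>j = Suc (p $ i)..q $ i. total (fst e (j, i)))"
proof -
  have "(\<Sum>j = 1..q $ i. f j) = (\<Sum>j = 1..p $ i. f j) + (\<Sum>j = Suc (p $ i)..q $ i. f j)"
    for i and f :: "nat \<Rightarrow> nat"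
  proof -
    have "{1..q $ i} = {1..p $ i} \<union> {Suc (p $ i)..q $ i}"
      using assms[unfolded less_eq_vec_def, rule_format, of i] by auto
    then show ?thesis by (simp add: sum.union_disjoint)
  qed
  then show ?thesis
    by (simp add: gw_step_def total_add total_sum sum.distrib)
qed

lemma gw_from_mono:
  assumes "v \<le> w"
  shows "gw_from v k n z \<le> gw_from w k n z"
  using assms by (induction k arbitrary: n) (auto intro: gw_step_mono)

lemma gw_from_0_Suc_mono: "gw_from 0 k n z \<le> gw_from 0 (Suc k) n z"
proof (induction k arbitrary: n)
  case (Suc k)
  show ?case using gw_step_mono[OF Suc[of "n - 1"], of "z n"] by simp
qed (simp add: less_eq_vec_def)

lemma gw_from_shift: "gw_from v k n (shift z) = gw_from v k (n + 1) z"
  by (induction k arbitrary: n) (auto simp: shift_def)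

lemma gw_limit_shift: "gw_limit n (shift z) = gw_limit (n + 1) z"
  by (simp add: gw_limit_def gw_from_shift)

lemma gw_limit_eq:
  assumes "\<forall>\<^sub>F k in sequentially. gw_from 0 k n z = x"
  shows "gw_limit n z = x"
  unfolding gw_limit_def
proof (rule the_equality[where P = "\<lambda>x. \<forall>\<^sub>F k in sequentially. gw_from 0 k n z = x", OF assms])
  fix y assume "\<forall>\<^sub>F k in sequentially. gw_from 0 k n z = y"
  with assms have "\<forall>\<^sub>F k in sequentially. x = y" by eventually_elim auto
  then show "y = x" by simp
qed

lemma gw_limit_step:
  assumes "\<forall>\<^sub>F k in sequentially. gw_from 0 k n z = x"
  shows "gw_limit (n + 1) z = gw_step (z (n + 1)) (gw_limit n z)"
proof (rule gw_limit_eq)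
  \<comment> \<open>With the starting time n - k kept fixed, observing one time unit later lengthens
    the run by one generation, hence \<open>Suc k\<close>.\<close>
  have "\<forall>\<^sub>F k in sequentially. gw_from 0 (Suc k) (n + 1) z = gw_step (z (n + 1)) (gw_limit n z)"
    using assms by eventually_elim (simp add: gw_limit_eq[OF assms])
  then show "\<forall>\<^sub>F k in sequentially. gw_from 0 k (n + 1) z = gw_step (z (n + 1)) (gw_limit n z)"
    by (simp add: eventually_sequentially_Suc[of "\<lambda>k. gw_from 0 k (n + 1) z = _", symmetric] del: gw_from.simps)
qed

lemma measurable_add_countable:
  fixes f g :: "'a \<Rightarrow> 'b::{countable,plus}"
  assumes "f \<in> measurable M (count_space UNIV)" "g \<in> measurable M (count_space UNIV)"
  shows "(\<lambda>x. f x + g x) \<in> measurable M (count_space UNIV)"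
proof (rule measurable_compose_countable[OF _ assms(1)])
  show "(\<lambda>x. y + g x) \<in> measurable M (count_space UNIV)" for y
    by (rule measurable_compose[OF assms(2)]) simp
qed

lemma measurable_sum_countable:
  fixes f :: "'i \<Rightarrow> 'a \<Rightarrow> 'b::{countable,comm_monoid_add}"
  assumes "\<And>i. i \<in> I \<Longrightarrow> f i \<in> measurable M (count_space UNIV)"
  shows "(\<lambda>x. \<Sum>i\<in>I. f i x) \<in> measurable M (count_space UNIV)"
  using assms by (induction I rule: infinite_finite_induct) (auto intro: measurable_add_countable)

lemma fst_env_measurable:
  assumes "1 \<le> j"
  shows "(\<lambda>e. fst e (j, i)) \<in> measurable env_space (count_space UNIV)"
proof -
  have "(\<lambda>x. x (j, i)) \<in> measurable (PiM ({1..} \<times> UNIV) (\<lambda>_. count_space UNIV)) (count_space UNIV)"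
    using assms by (intro measurable_component_singleton) auto
  then show ?thesis unfolding env_space_def by measurable
qed

lemma snd_env_measurable: "snd \<in> measurable env_space (count_space UNIV)"
  unfolding env_space_def by simp

text \<open>The upper summation limits are random. Since the state space is countable, it suffices
  to treat each fixed state y, for which the sums are finite with deterministic limits.\<close>

lemma gw_step_measurable:
  assumes f: "f \<in> measurable M env_space" and g: "g \<in> measurable M (count_space UNIV)"
  shows "(\<lambda>x. gw_step (f x) (g x)) \<in> measurable M (count_space UNIV)"
proof (rule measurable_compose_countable[OF _ g])
  show "(\<lambda>x. gw_step (f x) y) \<in> measurable M (count_space UNIV)" for y
    unfolding gw_step_def
    by (intro measurable_add_countable measurable_sum_countable
        measurable_compose[OF f fst_env_measurable] measurable_compose[OF f snd_env_measurable]) auto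
qed

text \<open>Only coordinates up to time n are required to be measurable, so that n = 0 gives
  measurability with respect to the past.\<close>

lemma gw_from_measurable:
  assumes "\<And>m. m \<le> n \<Longrightarrow> (\<lambda>x. z x m) \<in> measurable M env_space"
  shows "(\<lambda>x. gw_from v k n (z x)) \<in> measurable M (count_space UNIV)"
  using assms by (induction k arbitrary: n) (auto intro!: gw_step_measurable)

lemma gw_limit_measurable:
  fixes z :: "'a \<Rightarrow> int \<Rightarrow> 'd::finite environment"
  assumes "\<And>m. m \<le> n \<Longrightarrow> (\<lambda>x. z x m) \<in> measurable M env_space"
  shows "(\<lambda>x. gw_limit n (z x)) \<in> measurable M (count_space UNIV)"
  unfolding gw_limit_def
proof (rule measurable_THE[where I = UNIV])
  note [measurable] = gw_from_measurable[OF assms]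
  show "Measurable.pred M (\<lambda>x. \<forall>\<^sub>F k in sequentially. gw_from 0 k n (z x) = y)" for y :: "nat ^ 'd"
    unfolding eventually_sequentially by measurable
  show "countable (UNIV :: (nat ^ 'd) set)" by simp
  fix x and i j :: "nat ^ 'd"
  assume "\<forall>\<^sub>F k in sequentially. gw_from 0 k n (z x) = i" "\<forall>\<^sub>F k in sequentially. gw_from 0 k n (z x) = j"
  then show "i = j" by (metis gw_limit_eq)
qed simp

text \<open>The bounded integer totals attain their maximum at some k. From then on the states can
  only grow while their totals cannot, so they stay the same.\<close>

lemma gw_from_eventually_const:
  assumes "\<And>k. total (gw_from 0 k n z) \<le> c"
  shows "\<exists>x. \<forall>\<^sub>F k in sequentially. gw_from 0 k n z = x"
proof -
  let ?t = "\<lambda>k. total (gw_from 0 k n z)"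
  have mono: "gw_from 0 k n z \<le> gw_from 0 l n z" if "k \<le> l" for k l
    using that by (rule lift_Suc_mono_le[rotated]) (rule gw_from_0_Suc_mono)
  have fin: "finite (range ?t)" by (rule finite_subset[of _ "{..c}"]) (use assms in auto)
  then have "Max (range ?t) \<in> range ?t" by (intro Max_in) auto
  then obtain k where k: "?t k = Max (range ?t)" by force
  have "gw_from 0 l n z = gw_from 0 k n z" if "l \<ge> k" for l
  proof -
    have "?t l \<le> ?t k" unfolding k using fin by (intro Max_ge) auto
    with mono[OF that] show ?thesis by (metis eq_if_le_total_le)
  qed
  then show ?thesis by (auto simp: eventually_sequentially)
qed

section \<open>Contraction in mean\<close>

text \<open>Trades random summation limits for a series over all j with indicator weights, so that
  integral and sum can be exchanged.\<close>

lemma sum_atLeastAtMost_eq_suminf: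
  fixes a :: "nat \<Rightarrow> nat"
  shows "(of_nat (\<Sum>j = Suc p..q. a j) :: ennreal) = (\<Sum>j. of_nat (a j) * of_bool (p < j \<and> j \<le> q))"
proof -
  have "(\<Sum>j. of_nat (a j) * of_bool (p < j \<and> j \<le> q)) =
    (\<Sum>j = Suc p..q. of_nat (a j) * of_bool (p < j \<and> j \<le> q) :: ennreal)"
    by (rule suminf_finite) auto
  also have "\<dots> = (\<Sum>j = Suc p..q. of_nat (a j))"
    by (rule sum.cong) auto
  finally show ?thesis by simp
qed

text \<open>The conditional hypotheses enter only through \<open>offspring\<close>: the mean bound
  tested on past events, for each individual j separately.\<close>

locale branching = prob_space M for M :: "'w measure" +
  fixes Z :: "int \<Rightarrow> 'w \<Rightarrow> 'd::finite environment" and r :: ennreal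
  assumes stat: "stationary_process M env_space Z"
    and erg: "ergodic_process M env_space Z"
    and offspring: "\<And>i j G. 1 \<le> j \<Longrightarrow> G \<in> sets (past_algebra M env_space Z 0) \<Longrightarrow>
      (\<integral>\<^sup>+\<omega>. of_nat (total (fst (Z 1 \<omega>) (j, i))) * indicator G \<omega> \<partial>M) \<le> r * emeasure M G"
    and r_less_1: "r < 1"
    and immigration: "(\<integral>\<^sup>+\<omega>. of_nat (total (snd (Z 1 \<omega>))) \<partial>M) < \<infinity>"
begin

abbreviation environment :: "'w \<Rightarrow> int \<Rightarrow> 'd environment" where
  "environment \<omega> \<equiv> \<lambda>n. Z n \<omega>"

lemma Z_measurable [measurable]: "Z n \<in> measurable M env_space"
  using stat by (simp add: stationary_process_def)

lemma gw_from_measurable_M [measurable]: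
  "(\<lambda>\<omega>. gw_from v k n (environment \<omega>)) \<in> measurable M (count_space UNIV)"
  by (rule gw_from_measurable) simp

lemma gw_limit_measurable_M [measurable]:
  "(\<lambda>\<omega>. gw_limit n (environment \<omega>)) \<in> measurable M (count_space UNIV)"
  by (rule gw_limit_measurable) simp

lemma gw_from_measurable_path [measurable]:
  "gw_from v k n \<in> measurable (path_space env_space) (count_space UNIV)"
  by (rule gw_from_measurable) (rule coordinate_measurable)

lemma gw_from_measurable_past:
  "(\<lambda>\<omega>. gw_from v k 0 (environment \<omega>)) \<in> measurable (past_algebra M env_space Z 0) (count_space UNIV)"
  by (rule gw_from_measurable) (rule past_algebra_measurable(2)[OF Z_measurable])

text \<open>Both counts are known at time 0, so each event \<open>G i j\<close> that individual j is
  a surplus one lies in the past and its expected number of children is at most r times the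
  probability of \<open>G i j\<close>. Summing these probabilities over j gives back the expected
  surplus; the truncated difference counts the surplus correctly even where p exceeds q.\<close>

lemma offspring_between:
  assumes p: "p \<in> measurable (past_algebra M env_space Z 0) (count_space UNIV)"
    and q: "q \<in> measurable (past_algebra M env_space Z 0) (count_space UNIV)"
  shows "(\<integral>\<^sup>+\<omega>. of_nat (\<Sum>i\<in>UNIV. \<Sum>j = Suc (p \<omega> $ i)..q \<omega> $ i. total (fst (Z 1 \<omega>) (j, i))) \<partial>M)
    \<le> r * (\<integral>\<^sup>+\<omega>. of_nat (\<Sum>i\<in>UNIV. q \<omega> $ i - p \<omega> $ i) \<partial>M)"
proof -
  let ?F = "past_algebra M env_space Z 0"
  have sub: "subalgebra M ?F" by (rule past_algebra_measurable) simp
  have space_F: "space ?F = space M" using sub by (simp add: subalgebra_def)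
  have [measurable]: "p \<in> measurable M (count_space UNIV)" "q \<in> measurable M (count_space UNIV)"
    using measurable_from_subalg[OF sub] p q by auto
  define G where "G i j = {\<omega> \<in> space M. p \<omega> $ i < j \<and> j \<le> q \<omega> $ i}" for i j
  have G_F: "G i j \<in> sets ?F" for i j
  proof -
    note [measurable] = p q
    have "{\<omega> \<in> space ?F. p \<omega> $ i < j \<and> j \<le> q \<omega> $ i} \<in> sets ?F" by measurable
    then show ?thesis by (simp add: G_def space_F)
  qed
  then have [measurable]: "G i j \<in> sets M" for i j
    using sub by (auto simp: subalgebra_def)
  have [measurable]: "(\<lambda>\<omega>. of_nat (total (fst (Z 1 \<omega>) (j, i))) :: ennreal) \<in> borel_measurable M" if "1 \<le> j" for i j
    by (rule measurable_compose[OF measurable_compose[OF Z_measurable fst_env_measurable[OF that]]]) simp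
  have meas: "(\<lambda>\<omega>. of_nat (total (fst (Z 1 \<omega>) (j, i))) * indicator (G i j) \<omega> :: ennreal) \<in> borel_measurable M" for i j
  \<comment> \<open>Nothing is known about the offspring vector with index 0, but its event is
    empty.\<close>
  proof (cases "j = 0")
    case True
    then have "G i j = {}" by (auto simp: G_def)
    then show ?thesis by simp
  qed simp
  have "(\<integral>\<^sup>+\<omega>. of_nat (\<Sum>i\<in>UNIV. \<Sum>j = Suc (p \<omega> $ i)..q \<omega> $ i. total (fst (Z 1 \<omega>) (j, i))) \<partial>M)
      = (\<integral>\<^sup>+\<omega>. (\<Sum>i\<in>UNIV. \<Sum>j. of_nat (total (fst (Z 1 \<omega>) (j, i))) * indicator (G i j) \<omega>) \<partial>M)"
    unfolding of_nat_sum[of _ UNIV] sum_atLeastAtMost_eq_suminf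
    by (intro nn_integral_cong sum.cong refl suminf_cong) (auto simp: G_def indicator_def)
  also have "\<dots> = (\<Sum>i\<in>UNIV. \<Sum>j. \<integral>\<^sup>+\<omega>. of_nat (total (fst (Z 1 \<omega>) (j, i))) * indicator (G i j) \<omega> \<partial>M)"
    by (subst nn_integral_sum)
      (use meas in \<open>auto intro!: sum.cong nn_integral_suminf borel_measurable_suminf_order\<close>)
  also have "\<dots> \<le> (\<Sum>i\<in>UNIV. \<Sum>j. r * emeasure M (G i j))"
  proof (intro sum_mono suminf_le)
    show "(\<integral>\<^sup>+\<omega>. of_nat (total (fst (Z 1 \<omega>) (j, i))) * indicator (G i j) \<omega> \<partial>M) \<le> r * emeasure M (G i j)" for i j
    proof (cases "j = 0")
      case True
      then have "G i j = {}" by (auto simp: G_def)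
      then show ?thesis by simp
    qed (use offspring[OF _ G_F] in auto)
  qed auto
  also have "\<dots> = r * (\<Sum>i\<in>UNIV. \<Sum>j. \<integral>\<^sup>+\<omega>. indicator (G i j) \<omega> \<partial>M)"
    by (simp add: sum_distrib_left)
  also have "(\<Sum>i\<in>UNIV. \<Sum>j. \<integral>\<^sup>+\<omega>. indicator (G i j) \<omega> \<partial>M) = (\<integral>\<^sup>+\<omega>. (\<Sum>i\<in>UNIV. \<Sum>j. indicator (G i j) \<omega>) \<partial>M)"
    by (simp add: nn_integral_sum nn_integral_suminf)
  also have "\<dots> = (\<integral>\<^sup>+\<omega>. of_nat (\<Sum>i\<in>UNIV. q \<omega> $ i - p \<omega> $ i) \<partial>M)"
  proof (intro nn_integral_cong)
    fix \<omega> assume "\<omega> \<in> space M"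
    then have "(\<Sum>j. indicator (G i j) \<omega>) = (of_nat (q \<omega> $ i - p \<omega> $ i) :: ennreal)" for i
      using sum_atLeastAtMost_eq_suminf[of "\<lambda>_. 1" "p \<omega> $ i" "q \<omega> $ i"]
      by (simp add: G_def indicator_def)
    then show "(\<Sum>i\<in>UNIV. \<Sum>j. indicator (G i j) \<omega>) = (of_nat (\<Sum>i\<in>UNIV. q \<omega> $ i - p \<omega> $ i) :: ennreal)"
      by simp
  qed
  finally show ?thesis .
qed

text \<open>The conditional bound is available only for the step from time 0 to time 1; this
  transports the resulting estimates to every time n.\<close>

lemma nn_integral_path_stationary:
  fixes n :: int
  assumes "\<And>n. h n \<in> borel_measurable (path_space env_space)"
    and eq: "\<And>n z. h n (shift z) = h (n + 1) z"
  shows "(\<integral>\<^sup>+\<omega>. h n (environment \<omega>) \<partial>M) = (\<integral>\<^sup>+\<omega>. h 0 (environment \<omega>) \<partial>M)"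
proof -
  have step: "(\<integral>\<^sup>+\<omega>. h (n + 1) (environment \<omega>) \<partial>M) = (\<integral>\<^sup>+\<omega>. h n (environment \<omega>) \<partial>M)" for n
    using nn_integral_shift[OF stat assms(1)[of n]] by (simp add: eq)
  show ?thesis
  proof (induction n rule: int_induct[where k = 0])
    case (step2 i)
    then show ?case using step[of "i - 1"] by simp
  qed (use step in auto)
qed

text \<open>Stationarity moves the last generation step to time 1. The two states before it are then
  functions of the past, and \<open>offspring_between\<close> contributes one factor r.\<close>

lemma coupling_bound:
  "(\<integral>\<^sup>+\<omega>. of_nat (total (gw_from v k n (environment \<omega>)) - total (gw_from 0 k n (environment \<omega>))) \<partial>M)
    \<le> r ^ k * of_nat (total v)"
proof (induction k arbitrary: n)
  case 0
  then show ?case by (simp add: emeasure_space_1)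
next
  case (Suc k)
  let ?h = "\<lambda>n z. of_nat (total (gw_from v (Suc k) n z) - total (gw_from 0 (Suc k) n z)) :: ennreal"
  let ?p = "\<lambda>\<omega>. gw_from 0 k 0 (environment \<omega>)" and ?q = "\<lambda>\<omega>. gw_from v k 0 (environment \<omega>)"
  have le: "?p \<omega> \<le> ?q \<omega>" for \<omega> by (rule gw_from_mono) (simp add: less_eq_vec_def)
  have "?h n \<in> borel_measurable (path_space env_space)" for n
    by (simp del: gw_from.simps)
  then have stat_h: "(\<integral>\<^sup>+\<omega>. ?h n (environment \<omega>) \<partial>M) = (\<integral>\<^sup>+\<omega>. ?h 0 (environment \<omega>) \<partial>M)" for n
    by (rule nn_integral_path_stationary) (simp only: gw_from_shift)
  have diff: "total (?q \<omega>) - total (?p \<omega>) = (\<Sum>i\<in>UNIV. ?q \<omega> $ i - ?p \<omega> $ i)" for \<omega>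
    unfolding total_def using le[of \<omega>] by (subst sum_subtractf_nat) (auto simp: less_eq_vec_def)
  have "(\<integral>\<^sup>+\<omega>. ?h n (environment \<omega>) \<partial>M) = (\<integral>\<^sup>+\<omega>. ?h 1 (environment \<omega>) \<partial>M)"
    using stat_h[of n] stat_h[of 1] by (rule trans[OF _ sym])
  also have "\<dots> = (\<integral>\<^sup>+\<omega>. of_nat (\<Sum>i\<in>UNIV. \<Sum>j = Suc (?p \<omega> $ i)..?q \<omega> $ i. total (fst (Z 1 \<omega>) (j, i))) \<partial>M)"
    using total_gw_step[OF le] by simp
  also have "\<dots> \<le> r * (\<integral>\<^sup>+\<omega>. of_nat (total (?q \<omega>) - total (?p \<omega>)) \<partial>M)"
    unfolding diff by (rule offspring_between) (rule gw_from_measurable_past)+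
  also have "\<dots> \<le> r * (r ^ k * of_nat (total v))"
    by (intro mult_left_mono Suc) simp
  finally show ?case by (simp add: mult.assoc del: gw_from.simps)
qed

text \<open>The fixed point of c = r c + b with b the mean immigration, that is, the sum of b r^k
  over all k. Forming it in the reals makes its finiteness immediate.\<close>

definition mean_bound :: ennreal where
  "mean_bound = ennreal (enn2real (\<integral>\<^sup>+\<omega>. of_nat (total (snd (Z 1 \<omega>))) \<partial>M) / (1 - enn2real r))"

lemma r_real: "r = ennreal (enn2real r)" "enn2real r < 1"
proof -
  have "r < top" using r_less_1 by (rule less_trans) simp
  then show eq: "r = ennreal (enn2real r)" by simp
  have "ennreal (enn2real r) < ennreal 1" using r_less_1 eq by simp
  then show "enn2real r < 1" by (simp add: ennreal_less_iff)
qed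

lemma mean_bound: "r * mean_bound + (\<integral>\<^sup>+\<omega>. of_nat (total (snd (Z 1 \<omega>))) \<partial>M) = mean_bound"
proof -
  let ?b = "\<integral>\<^sup>+\<omega>. of_nat (total (snd (Z 1 \<omega>))) \<partial>M"
  note r = r_real
  have b: "?b = ennreal (enn2real ?b)" using immigration by (simp add: less_top[symmetric])
  have "r * mean_bound + ?b = ennreal (enn2real r * (enn2real ?b / (1 - enn2real r)) + enn2real ?b)"
    unfolding mean_bound_def using r(2)
    by (subst r(1), subst b) (simp add: ennreal_mult[symmetric] ennreal_plus[symmetric] del: ennreal_plus)
  also have "enn2real r * (enn2real ?b / (1 - enn2real r)) + enn2real ?b = enn2real ?b / (1 - enn2real r)"
  proof -
    have "c * (b / (1 - c)) + b = b / (1 - c)" if "1 - c \<noteq> 0" for b c :: real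
      using that by (simp add: field_simps)
    then show ?thesis by this (use r(2) in linarith)
  qed
  finally show ?thesis by (simp add: mean_bound_def)
qed

lemma gw_from_0_bound:
  "(\<integral>\<^sup>+\<omega>. of_nat (total (gw_from 0 k n (environment \<omega>))) \<partial>M) \<le> mean_bound"
proof (induction k arbitrary: n)
  case 0
  then show ?case by simp
next
  case (Suc k)
  let ?h = "\<lambda>n z. of_nat (total (gw_from 0 (Suc k) n z)) :: ennreal"
  let ?q = "\<lambda>\<omega>. gw_from 0 k 0 (environment \<omega>)"
  \<comment> \<open>The children of the whole population, seen as the surplus over the empty
    population p = 0.\<close>
  let ?S = "\<lambda>\<omega>. \<Sum>i\<in>UNIV. \<Sum>j = Suc 0..?q \<omega> $ i. total (fst (Z 1 \<omega>) (j, i))"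
  have "?h n \<in> borel_measurable (path_space env_space)" for n
    by (simp del: gw_from.simps)
  then have stat_h: "(\<integral>\<^sup>+\<omega>. ?h n (environment \<omega>) \<partial>M) = (\<integral>\<^sup>+\<omega>. ?h 0 (environment \<omega>) \<partial>M)" for n
    by (rule nn_integral_path_stationary) (simp only: gw_from_shift)
  have B_meas: "(\<lambda>\<omega>. of_nat (total (snd (Z 1 \<omega>))) :: ennreal) \<in> borel_measurable M"
    by (rule measurable_compose[OF measurable_compose[OF Z_measurable snd_env_measurable]]) simp
  have total: "total (gw_from 0 (Suc k) 1 (environment \<omega>)) = ?S \<omega> + total (snd (Z 1 \<omega>))" for \<omega>
    using total_gw_step[of 0 "?q \<omega>" "Z 1 \<omega>"] by (simp add: less_eq_vec_def)
  have S_meas: "(\<lambda>\<omega>. of_nat (?S \<omega>) :: ennreal) \<in> borel_measurable M"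
  proof -
    \<comment> \<open>Measurability of a sum with random limits is obtained by removing the
      immigrants from the next state.\<close>
    have "?S \<omega> = total (gw_step (Z 1 \<omega>) (?q \<omega>)) - total (snd (Z 1 \<omega>))" for \<omega>
      using total[of \<omega>] by simp
    moreover have "(\<lambda>\<omega>. total (gw_step (Z 1 \<omega>) (?q \<omega>)) - total (snd (Z 1 \<omega>))) \<in> measurable M (count_space UNIV)"
    proof (rule measurable_compose_countable[where f = "\<lambda>y \<omega>. total y - total (snd (Z 1 \<omega>))"])
      show "(\<lambda>\<omega>. gw_step (Z 1 \<omega>) (?q \<omega>)) \<in> measurable M (count_space UNIV)"
        by (rule gw_step_measurable) simp_all
      show "(\<lambda>\<omega>. total y - total (snd (Z 1 \<omega>))) \<in> measurable M (count_space UNIV)" for y :: "nat ^ 'd"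
        by (rule measurable_compose[OF measurable_compose[OF Z_measurable snd_env_measurable]]) simp
    qed
    ultimately show ?thesis by simp
  qed
  have "(\<integral>\<^sup>+\<omega>. ?h n (environment \<omega>) \<partial>M) = (\<integral>\<^sup>+\<omega>. ?h 1 (environment \<omega>) \<partial>M)"
    using stat_h[of n] stat_h[of 1] by (rule trans[OF _ sym])
  also have "\<dots> = (\<integral>\<^sup>+\<omega>. of_nat (?S \<omega>) \<partial>M) + (\<integral>\<^sup>+\<omega>. of_nat (total (snd (Z 1 \<omega>))) \<partial>M)"
    unfolding total of_nat_add by (rule nn_integral_add[OF S_meas B_meas])
  also have "(\<integral>\<^sup>+\<omega>. of_nat (?S \<omega>) \<partial>M) \<le> r * (\<integral>\<^sup>+\<omega>. of_nat (total (?q \<omega>)) \<partial>M)"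
    using offspring_between[of "\<lambda>_. 0" ?q] gw_from_measurable_past by (simp add: total_def)
  also have "\<dots> \<le> r * mean_bound"
    by (intro mult_left_mono Suc) simp
  finally show ?case by (simp add: mean_bound add_right_mono del: gw_from.simps)
qed

text \<open>With k = n both runs start at time 0 and move forward. Their expected differences have a
  finite sum, so almost surely the integer differences are summable and eventually 0. As there are
  countably many v, one null set serves all of them.\<close>

lemma gw_from_coupling:
  "AE \<omega> in M. \<forall>v. \<forall>\<^sub>F n in sequentially.
    gw_from v n (int n) (environment \<omega>) = gw_from 0 n (int n) (environment \<omega>)"
proof (subst AE_all_countable, rule allI)
  fix v :: "nat ^ 'd"
  let ?D = "\<lambda>n \<omega>. total (gw_from v n (int n) (environment \<omega>)) - total (gw_from 0 n (int n) (environment \<omega>))"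
  have [measurable]: "(\<lambda>\<omega>. of_nat (?D n \<omega>) :: ennreal) \<in> borel_measurable M" for n by simp
  have "(\<integral>\<^sup>+\<omega>. (\<Sum>n. of_nat (?D n \<omega>)) \<partial>M) = (\<Sum>n. \<integral>\<^sup>+\<omega>. of_nat (?D n \<omega>) \<partial>M)"
    by (rule nn_integral_suminf) simp
  also have "\<dots> \<le> (\<Sum>n. r ^ n * of_nat (total v))"
    by (intro suminf_le coupling_bound) auto
  also have "\<dots> = ennreal (1 / (1 - enn2real r)) * of_nat (total v)"
  proof -
    note r = r_real
    have "(\<lambda>n. enn2real r ^ n) sums (1 / (1 - enn2real r))"
      by (rule geometric_sums) (use r in auto)
    then have "(\<Sum>n. ennreal (enn2real r ^ n)) = ennreal (1 / (1 - enn2real r))"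
      by (intro suminf_ennreal_eq) auto
    moreover have "r ^ n = ennreal (enn2real r ^ n)" for n
      by (subst r(1)) (simp add: ennreal_power)
    ultimately show ?thesis by (simp add: ennreal_suminf_multc)
  qed
  also have "\<dots> < \<infinity>" by (simp add: ennreal_mult_less_top ennreal_of_nat_eq_real_of_nat)
  finally have "AE \<omega> in M. (\<Sum>n. of_nat (?D n \<omega>) :: ennreal) \<noteq> \<infinity>"
    by (intro nn_integral_PInf_AE) auto
  then show "AE \<omega> in M. \<forall>\<^sub>F n in sequentially.
      gw_from v n (int n) (environment \<omega>) = gw_from 0 n (int n) (environment \<omega>)"
  proof eventually_elim
    case (elim \<omega>)
    have "summable (\<lambda>n. real (?D n \<omega>))"
      using elim by (intro summable_suminf_not_top) (auto simp: ennreal_of_nat_eq_real_of_nat)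
    then have "(\<lambda>n. real (?D n \<omega>)) \<longlonglongrightarrow> 0" by (rule summable_LIMSEQ_zero)
    then have "\<forall>\<^sub>F n in sequentially. real (?D n \<omega>) < 1"
      by (rule order_tendstoD) simp
    then show ?case
    proof eventually_elim
      case (elim n)
      then have "total (gw_from v n (int n) (environment \<omega>)) \<le> total (gw_from 0 n (int n) (environment \<omega>))"
        by linarith
      then show ?case
        by (intro eq_if_le_total_le[symmetric] gw_from_mono) (auto simp: less_eq_vec_def)
    qed
  qed
qed

text \<open>Monotonicity in k turns the uniform bound on means into a bound on the mean of the
  supremum, which gives both almost sure finiteness and the mean of the limit.\<close>

lemma total_sup_finite:
  "(\<integral>\<^sup>+\<omega>. (SUP k. of_nat (total (gw_from 0 k n (environment \<omega>)))) \<partial>M) \<le> mean_bound"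
proof -
  have "(\<integral>\<^sup>+\<omega>. (SUP k. of_nat (total (gw_from 0 k n (environment \<omega>)))) \<partial>M)
      = (SUP k. \<integral>\<^sup>+\<omega>. of_nat (total (gw_from 0 k n (environment \<omega>))) \<partial>M)"
  proof (rule nn_integral_monotone_convergence_SUP)
    show "incseq (\<lambda>k \<omega>. of_nat (total (gw_from 0 k n (environment \<omega>))) :: ennreal)"
      by (intro incseq_SucI le_funI) (metis of_nat_mono total_mono gw_from_0_Suc_mono)
  qed simp
  also have "\<dots> \<le> mean_bound" by (intro SUP_least gw_from_0_bound)
  finally show ?thesis .
qed

lemma gw_from_converges:
  "AE \<omega> in M. \<forall>n. \<exists>x. \<forall>\<^sub>F k in sequentially. gw_from 0 k n (environment \<omega>) = x"
proof (subst AE_all_countable, rule allI)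
  fix n
  have "(\<integral>\<^sup>+\<omega>. (SUP k. of_nat (total (gw_from 0 k n (environment \<omega>)))) \<partial>M) < \<infinity>"
    using total_sup_finite[of n] by (rule le_less_trans) (simp add: mean_bound_def)
  then have "AE \<omega> in M. (SUP k. of_nat (total (gw_from 0 k n (environment \<omega>))) :: ennreal) \<noteq> \<infinity>"
    by (intro nn_integral_PInf_AE) auto
  then show "AE \<omega> in M. \<exists>x. \<forall>\<^sub>F k in sequentially. gw_from 0 k n (environment \<omega>) = x"
  proof eventually_elim
    case (elim \<omega>)
    then obtain c where c: "(SUP k. of_nat (total (gw_from 0 k n (environment \<omega>))) :: ennreal) < of_nat c"
      using ennreal_Ex_less_of_nat[of "SUP k. of_nat (total (gw_from 0 k n (environment \<omega>)))"]
      by (metis infinity_ennreal_def less_top)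
    have "total (gw_from 0 k n (environment \<omega>)) \<le> c" for k
    proof -
      have "(of_nat (total (gw_from 0 k n (environment \<omega>))) :: ennreal) < of_nat c"
        using c by (rule le_less_trans[rotated]) (rule SUP_upper, simp)
      then show ?thesis by simp
    qed
    then show ?case by (rule gw_from_eventually_const)
  qed
qed

lemma gw_limit_mean: "(\<integral>\<^sup>+\<omega>. of_nat (total (gw_limit n (environment \<omega>))) \<partial>M) < \<infinity>"
proof -
  have "AE \<omega> in M. (of_nat (total (gw_limit n (environment \<omega>))) :: ennreal)
      \<le> (SUP k. of_nat (total (gw_from 0 k n (environment \<omega>))))"
    using gw_from_converges
  proof eventually_elim
    case (elim \<omega>)
    then obtain x where x: "\<forall>\<^sub>F k in sequentially. gw_from 0 k n (environment \<omega>) = x" by blast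
    then obtain k where "gw_from 0 k n (environment \<omega>) = gw_limit n (environment \<omega>)"
      using gw_limit_eq[OF x] by (auto simp: eventually_sequentially)
    moreover have "(of_nat (total (gw_from 0 k n (environment \<omega>))) :: ennreal)
        \<le> (SUP k. of_nat (total (gw_from 0 k n (environment \<omega>))))"
      by (rule SUP_upper) simp
    ultimately show ?case by simp
  qed
  then have "(\<integral>\<^sup>+\<omega>. of_nat (total (gw_limit n (environment \<omega>))) \<partial>M) \<le> mean_bound"
    by (rule order_trans[OF nn_integral_mono_AE total_sup_finite])
  also have "\<dots> < \<infinity>" by (simp add: mean_bound_def)
  finally show ?thesis .
qed

lemma gw_limit_stationary_ergodic:
  shows "stationary_process M (count_space UNIV) (\<lambda>n \<omega>. gw_limit (int n) (environment \<omega>))"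
    and "ergodic_process M (count_space UNIV) (\<lambda>n \<omega>. gw_limit (int n) (environment \<omega>))"
proof -
  let ?\<Phi> = "\<lambda>z (n::nat). gw_limit (int n) z"
  have meas: "?\<Phi> \<in> measurable (path_space env_space) (path_space (count_space UNIV))"
    by (rule path_measurable) (rule gw_limit_measurable, rule coordinate_measurable)
  have equiv: "?\<Phi> (shift z) = shift (?\<Phi> z)" for z
    unfolding shift_def[of "?\<Phi> z"] gw_limit_shift by (simp add: add.commute)
  show "stationary_process M (count_space UNIV) (\<lambda>n \<omega>. gw_limit (int n) (environment \<omega>))"
    and "ergodic_process M (count_space UNIV) (\<lambda>n \<omega>. gw_limit (int n) (environment \<omega>))"
    using stationary_ergodic_factor[OF stat erg meas equiv] by simp_all
qed

end

section \<open>Strong stability and the law of large numbers\<close>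

lemma l1_norm_real_vec: "l1_norm (real_vec x) = real (total x)"
  by (simp add: l1_norm_def real_vec_def total_def)

lemma gw_step_env:
  "gw_step (env A B n \<omega>) x = (\<Sum>i\<in>UNIV. \<Sum>j = 1..x $ i. A n j i \<omega>) + B n \<omega>"
  by (simp add: gw_step_def env_def)

lemma GW_Suc: "GW A B V (Suc n) \<omega> = gw_step (env A B (int (Suc n)) \<omega>) (GW A B V n \<omega>)"
  by (simp add: gw_step_env)

lemma GW_eq_gw_from: "GW A B V n \<omega> = gw_from (V \<omega>) n (int n) (\<lambda>m. env A B m \<omega>)"
  by (induction n) (simp_all add: GW_Suc del: GW.simps(2))

lemma GW_measurable:
  assumes "\<And>n. env A B n \<in> measurable M env_space" "V \<in> measurable M (count_space UNIV)"
  shows "GW A B V n \<in> measurable M (count_space UNIV)"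
proof (induction n)
  case (Suc n)
  have "GW A B V (Suc n) = (\<lambda>\<omega>. gw_step (env A B (int (Suc n)) \<omega>) (GW A B V n \<omega>))"
    by (intro ext GW_Suc)
  with gw_step_measurable[OF assms(1) Suc] show ?case by simp
qed (simp add: assms(2))

lemma cesaro_eventually_eq:
  fixes a b :: "nat \<Rightarrow> real"
  assumes eq: "\<forall>\<^sub>F n in sequentially. a n = b n"
    and lim: "(\<lambda>n. (\<Sum>i<n. b i) / real n) \<longlonglongrightarrow> l"
  shows "(\<lambda>n. (\<Sum>i = 1..n. a i) / real n) \<longlonglongrightarrow> l"
proof -
  obtain N where N: "\<And>n. n \<ge> N \<Longrightarrow> a n = b n"
    using eq by (auto simp: eventually_sequentially)
  \<comment> \<open>Collects the finitely many discrepancies before N and the change of range: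
    Birkhoff averages start at index 0, the strong law at index 1.\<close>
  define c where "c = (\<Sum>i<N. a i - b i) - a 0"
  have sum_eq: "(\<Sum>i = 1..n. a i) = (\<Sum>i<Suc n. b i) + c" if "n \<ge> N" for n
  proof -
    have "(\<Sum>i<Suc n. a i - b i) = (\<Sum>i<N. a i - b i)"
      using that N by (intro sum.mono_neutral_right) auto
    moreover have "(\<Sum>i<Suc n. a i) = a 0 + (\<Sum>i = 1..n. a i)"
      by (subst sum.lessThan_Suc_shift) (simp add: sum.atLeast1_atMost_eq)
    ultimately show ?thesis by (simp add: c_def sum_subtractf)
  qed
  \<comment> \<open>The sum has n + 1 terms but is divided by n; the correction factor tends to
    1.\<close>
  have "(\<lambda>n. (\<Sum>i<Suc n. b i) / real (Suc n) * (real (Suc n) / real n) + c / real n) \<longlonglongrightarrow> l * 1 + 0"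
  proof (intro tendsto_add tendsto_mult)
    show "(\<lambda>n. (\<Sum>i<Suc n. b i) / real (Suc n)) \<longlonglongrightarrow> l"
      using lim by (rule LIMSEQ_Suc)
    show "(\<lambda>n. real (Suc n) / real n) \<longlonglongrightarrow> 1" by (rule LIMSEQ_Suc_n_over_n)
    show "(\<lambda>n. c / real n) \<longlonglongrightarrow> 0" by (rule lim_const_over_n)
  qed
  moreover have "\<forall>\<^sub>F n in sequentially. (\<Sum>i<Suc n. b i) / real (Suc n) * (real (Suc n) / real n) + c / real n
      = (\<Sum>i = 1..n. a i) / real n"
    using eventually_ge_at_top[of N]
  proof eventually_elim
    case (elim n)
    show ?case
      unfolding sum_eq[OF elim] by (simp add: add_divide_distrib del: sum.lessThan_Suc of_nat_Suc)
  qed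
  ultimately have "(\<lambda>n. (\<Sum>i = 1..n. a i) / real n) \<longlonglongrightarrow> l * 1 + 0"
    by (rule Lim_transform_eventually)
  then show ?thesis by simp
qed

lemma real_vec_axis: "real_vec x = (\<Sum>k\<in>UNIV. real (x $ k) *\<^sub>R axis k 1)"
  by (simp add: vec_eq_iff real_vec_def axis_def if_distrib cong: if_cong)

lemma integrable_real_vec:
  assumes [measurable]: "V \<in> measurable M (count_space UNIV)"
    and fin: "(\<integral>\<^sup>+\<omega>. of_nat (total (V \<omega>)) \<partial>M) < \<infinity>"
  shows "integrable M (\<lambda>\<omega>. real (V \<omega> $ k))" "integrable M (\<lambda>\<omega>. real_vec (V \<omega>))"
proof -
  show int: "integrable M (\<lambda>\<omega>. real (V \<omega> $ k))" for k
  proof (rule integrableI_bounded)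
    have "(\<integral>\<^sup>+\<omega>. ennreal (norm (real (V \<omega> $ k))) \<partial>M) \<le> (\<integral>\<^sup>+\<omega>. of_nat (total (V \<omega>)) \<partial>M)"
      by (intro nn_integral_mono) (simp add: ennreal_of_nat_eq_real_of_nat component_le_total)
    with fin show "(\<integral>\<^sup>+\<omega>. ennreal (norm (real (V \<omega> $ k))) \<partial>M) < \<infinity>"
      by (rule le_less_trans[rotated])
  qed simp
  show "integrable M (\<lambda>\<omega>. real_vec (V \<omega>))"
    unfolding real_vec_axis using int by (intro Bochner_Integration.integrable_sum integrable_scaleR_left) auto
qed

locale galton_watson = branching M "env A B" r
  for M :: "'w measure" and A :: "int \<Rightarrow> nat \<Rightarrow> 'd::finite \<Rightarrow> 'w \<Rightarrow> nat ^ 'd" and B r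
begin

text \<open>For a fixed outcome only the two initial values matter, and the null set of
  \<open>gw_from_coupling\<close> does not depend on them. So V and W may be quantified inside the
  almost sure statement and may depend on the trajectory in any way.\<close>

lemma GW_coupling:
  "AE \<omega> in M. \<forall>V W. \<forall>\<^sub>F n in sequentially. GW A B V n \<omega> = GW A B W n \<omega>"
  using gw_from_coupling
proof eventually_elim
  case (elim \<omega>)
  show ?case
  proof (intro allI)
    fix V W
    show "\<forall>\<^sub>F n in sequentially. GW A B V n \<omega> = GW A B W n \<omega>"
      using elim[rule_format, of "V \<omega>"] elim[rule_format, of "W \<omega>"]
      by eventually_elim (simp add: GW_eq_gw_from)
  qed
qed

definition limit_start :: "'w \<Rightarrow> nat ^ 'd" where
  "limit_start \<omega> = gw_limit 0 (environment \<omega>)"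

lemma limit_start_measurable [measurable]: "limit_start \<in> measurable M (count_space UNIV)"
  unfolding limit_start_def[abs_def] by simp

lemma GW_limit_start:
  "AE \<omega> in M. \<forall>n. GW A B limit_start n \<omega> = gw_limit (int n) (environment \<omega>)"
  using gw_from_converges
proof eventually_elim
  case (elim \<omega>)
  show ?case
  proof
    fix n
    show "GW A B limit_start n \<omega> = gw_limit (int n) (environment \<omega>)"
    proof (induction n)
      case (Suc n)
      obtain x where "\<forall>\<^sub>F k in sequentially. gw_from 0 k (int n) (environment \<omega>) = x"
        using elim by blast
      from gw_limit_step[OF this] show ?case
        by (simp add: GW_Suc Suc add.commute del: GW.simps(2))
    qed (simp add: limit_start_def)
  qed
qed

lemma stable_start_limit_start: "stable_start M (GW A B) limit_start"
  unfolding stable_start_def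
proof (intro conjI ballI)
  have GW: "GW A B limit_start n \<in> measurable M (count_space UNIV)" for n
    by (rule GW_measurable) simp_all
  show "stationary_process M (count_space UNIV) (GW A B limit_start)"
    "ergodic_process M (count_space UNIV) (GW A B limit_start)"
    by (rule stationary_ergodic_cong_AE[OF gw_limit_stationary_ergodic GW GW_limit_start])+
  fix V :: "'w \<Rightarrow> nat ^ 'd"
  show "AE \<omega> in M. (\<lambda>n. real_vec (GW A B V n \<omega>) - real_vec (GW A B limit_start n \<omega>)) \<longlonglongrightarrow> 0"
    using GW_coupling
  proof eventually_elim
    case (elim \<omega>)
    from elim[rule_format, of V limit_start]
    have "\<forall>\<^sub>F n in sequentially. real_vec (GW A B V n \<omega>) - real_vec (GW A B limit_start n \<omega>) = 0"
      by eventually_elim simp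
    then show ?case by (rule tendsto_eventually)
  qed
qed simp

text \<open>Transfers the finite mean of \<open>limit_start\<close> to every admissible start. The
  difference of the probabilities of E does not change with n by stationarity, and tends to 0 by
  coupling and dominated convergence.\<close>

lemma stable_start_distr_unique:
  assumes V: "stable_start M (GW A B) V" and W: "stable_start M (GW A B) W"
  shows "distr M (count_space UNIV) V = distr M (count_space UNIV) W"
proof (rule measure_eqI)
  have start: "U \<in> measurable M (count_space UNIV)"
    "\<And>n. GW A B U n \<in> measurable M (count_space UNIV)"
    "\<And>n. distr M (count_space UNIV) (GW A B U n) = distr M (count_space UNIV) U"
    if "stable_start M (GW A B) U" for U
    using that stationary_process_distr[of M "count_space UNIV" "GW A B U"]
    by (auto simp: stable_start_def stationary_process_def)
  note [measurable] = start(1,2)[OF V] start(1,2)[OF W]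
  fix E :: "(nat ^ 'd) set"
  have prob_n: "(\<integral>\<omega>. indicator E (GW A B U n \<omega>) \<partial>M) = measure (distr M (count_space UNIV) U) E"
    if U: "stable_start M (GW A B) U" for U n
  proof -
    note [measurable] = start(1,2)[OF U]
    have "measure (distr M (count_space UNIV) U) E = measure M (GW A B U n -` E \<inter> space M)"
      unfolding start(3)[OF U, of n, symmetric] by (subst measure_distr) auto
    also have "\<dots> = (\<integral>\<omega>. indicator (GW A B U n -` E \<inter> space M) \<omega> \<partial>M)"
      by simp
    also have "\<dots> = (\<integral>\<omega>. indicator E (GW A B U n \<omega>) \<partial>M)"
      by (intro Bochner_Integration.integral_cong) (auto simp: indicator_def)
    finally show ?thesis by simp
  qed
  have int: "integrable M (\<lambda>\<omega>. indicator E (GW A B U n \<omega>) :: real)"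
    if "stable_start M (GW A B) U" for U n
    using start(2)[OF that, of n]
    by (intro integrable_const_bound[where B = 1] AE_I2) (auto simp: indicator_def)
  let ?D = "\<lambda>n \<omega>. indicator E (GW A B V n \<omega>) - indicator E (GW A B W n \<omega>) :: real"
  have "(\<lambda>n. \<integral>\<omega>. ?D n \<omega> \<partial>M) \<longlonglongrightarrow> (\<integral>\<omega>. 0 \<partial>M)"
  proof (rule integral_dominated_convergence[where w = "\<lambda>_. 1"])
    show "AE \<omega> in M. (\<lambda>n. ?D n \<omega>) \<longlonglongrightarrow> 0"
      using GW_coupling
    proof eventually_elim
      case (elim \<omega>)
      from elim[rule_format, of V W] have "\<forall>\<^sub>F n in sequentially. ?D n \<omega> = 0"
        by eventually_elim simp
      then show ?case by (rule tendsto_eventually)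
    qed
    show "AE \<omega> in M. norm (?D n \<omega>) \<le> 1" for n
      by (rule AE_I2) (auto simp: indicator_def)
  qed auto
  moreover have "(\<integral>\<omega>. ?D n \<omega> \<partial>M) =
      measure (distr M (count_space UNIV) V) E - measure (distr M (count_space UNIV) W) E" for n
    using int V W by (simp add: prob_n)
  ultimately have "measure (distr M (count_space UNIV) V) E = measure (distr M (count_space UNIV) W) E"
    by (simp add: LIMSEQ_const_iff)
  then show "emeasure (distr M (count_space UNIV) V) E = emeasure (distr M (count_space UNIV) W) E"
    using finite_measure_distr[of V "count_space UNIV"] finite_measure_distr[of W "count_space UNIV"]
    by (simp add: finite_measure.emeasure_eq_measure)
qed simp

lemma stable_start_mean:
  assumes V: "stable_start M (GW A B) V"
  shows "(\<integral>\<^sup>+\<omega>. of_nat (total (V \<omega>)) \<partial>M) < \<infinity>"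
proof -
  have [measurable]: "V \<in> measurable M (count_space UNIV)" using V by (simp add: stable_start_def)
  have "(\<integral>\<^sup>+\<omega>. of_nat (total (V \<omega>)) \<partial>M) = (\<integral>\<^sup>+x. of_nat (total x) \<partial>distr M (count_space UNIV) V)"
    by (simp add: nn_integral_distr)
  also have "\<dots> = (\<integral>\<^sup>+\<omega>. of_nat (total (limit_start \<omega>)) \<partial>M)"
    unfolding stable_start_distr_unique[OF V stable_start_limit_start] by (simp add: nn_integral_distr)
  also have "\<dots> < \<infinity>"
    unfolding limit_start_def by (rule gw_limit_mean)
  finally show ?thesis .
qed

text \<open>The ergodic theorem is applied to each coordinate of the process started from V itself;
  coupling then replaces V by W at the cost of finitely many terms.\<close>

lemma stable_start_SLLN:
  assumes V: "stable_start M (GW A B) V"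
  shows "AE \<omega> in M. (\<lambda>n. (1 / real n) *\<^sub>R (\<Sum>i = 1..n. real_vec (GW A B W i \<omega>)))
    \<longlonglongrightarrow> (\<integral>\<omega>. real_vec (V \<omega>) \<partial>M)"
proof -
  have V_meas: "V \<in> measurable M (count_space UNIV)" using V by (simp add: stable_start_def)
  note int = integrable_real_vec[OF V_meas stable_start_mean[OF V]]
  have "AE \<omega> in M. (\<lambda>n. (\<Sum>i<n. real (GW A B V i \<omega> $ k)) / real n) \<longlonglongrightarrow> (\<integral>\<omega>. real (V \<omega> $ k) \<partial>M)" for k
    using birkhoff_process[of "count_space UNIV" "GW A B V" "\<lambda>x. real (x $ k)"] V int(1)[of k]
    by (simp add: stable_start_def)
  then have "AE \<omega> in M. \<forall>k. (\<lambda>n. (\<Sum>i<n. real (GW A B V i \<omega> $ k)) / real n) \<longlonglongrightarrow> (\<integral>\<omega>. real (V \<omega> $ k) \<partial>M)"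
    by (simp add: AE_all_countable)
  with GW_coupling show ?thesis
  proof eventually_elim
    case (elim \<omega>)
    show ?case
    proof (rule vec_tendstoI)
      fix k
      have "(\<integral>\<omega>. real_vec (V \<omega>) \<partial>M) $ k = (\<integral>\<omega>. real_vec (V \<omega>) $ k \<partial>M)"
        by (rule integral_bounded_linear[OF bounded_linear_vec_nth int(2), symmetric])
      then have mean: "(\<integral>\<omega>. real_vec (V \<omega>) \<partial>M) $ k = (\<integral>\<omega>. real (V \<omega> $ k) \<partial>M)"
        by (simp add: real_vec_def)
      from elim(1)[rule_format, of W V]
      have "\<forall>\<^sub>F n in sequentially. real (GW A B W n \<omega> $ k) = real (GW A B V n \<omega> $ k)"
        by eventually_elim simp
      from cesaro_eventually_eq[OF this elim(2)[rule_format]]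
      show "(\<lambda>n. ((1 / real n) *\<^sub>R (\<Sum>i = 1..n. real_vec (GW A B W i \<omega>))) $ k)
          \<longlonglongrightarrow> (\<integral>\<omega>. real_vec (V \<omega>) \<partial>M) $ k"
        unfolding mean by (simp add: real_vec_def)
    qed
  qed
qed

lemma GW_strongly_stable: "strongly_stable M (GW A B)"
  unfolding strongly_stable_def using stable_start_limit_start by blast

lemma GW_SLLN: "SLLN M (GW A B)"
  unfolding SLLN_def
  using GW_strongly_stable stable_start_SLLN integrable_real_vec(2)[OF _ stable_start_mean]
  by (auto simp: stable_start_def)

end

theorem proposition5:
  fixes M :: "'w measure"
    and A :: "int \<Rightarrow> nat \<Rightarrow> 'd::finite \<Rightarrow> 'w \<Rightarrow> nat ^ 'd"
    and B :: "int \<Rightarrow> 'w \<Rightarrow> nat ^ 'd"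
    and \<rho> :: real
  defines "F0 \<equiv> past_algebra M env_space (env A B) 0"
  assumes "prob_space M"
    and "\<And>n j i. j \<ge> 1 \<Longrightarrow> A n j i \<in> measurable M (count_space UNIV)"
    and "\<And>n. B n \<in> measurable M (count_space UNIV)"
    and "stationary_process M env_space (env A B)"
    and "ergodic_process M env_space (env A B)"
    and "\<And>i j k. j \<ge> 1 \<Longrightarrow> k \<ge> 1 \<Longrightarrow>
           same_cond_law M F0 (count_space UNIV) (A 1 j i) (A 1 k i)"
    and "\<rho> < 1"
    and "AE \<omega> in M.
           enn2ereal (MAX i. l1_norm_ennreal (cond_mean M F0 (A 1 1 i) \<omega>)) \<le> ereal \<rho>"
    and "integrable M (\<lambda>\<omega>. l1_norm (real_vec (B 1 \<omega>)))"
  shows "strongly_stable M (GW A B) \<and> SLLN M (GW A B)"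
proof -
  interpret prob_space M by fact
  note A = assms(3) and same_law = assms(7) and mean = assms(9)
  have sub: "subalgebra M F0"
    unfolding F0_def using assms(5) by (intro past_algebra_measurable) (simp add: stationary_process_def)
  have mean_i: "AE \<omega> in M. l1_norm_ennreal (cond_mean M F0 (A 1 1 i) \<omega>) \<le> ennreal \<rho>" for i
    using mean
  proof eventually_elim
    case (elim \<omega>)
    let ?m = "\<lambda>i. l1_norm_ennreal (cond_mean M F0 (A 1 1 i) \<omega>)"
    have "enn2ereal (?m i) \<le> enn2ereal (MAX i. ?m i)"
      by (simp add: less_eq_ennreal.rep_eq[symmetric])
    with elim have "enn2ereal (?m i) \<le> ereal \<rho>" by (rule order_trans[rotated])
    \<comment> \<open>\<open>e2ennreal\<close> truncates at 0 just as \<open>ennreal\<close> does,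
      so a negative \<rho> is covered as well.\<close>
    then have "e2ennreal (enn2ereal (?m i)) \<le> e2ennreal (ereal \<rho>)" by (rule e2ennreal_mono)
    then show "?m i \<le> ennreal \<rho>" by (simp add: e2ennreal_enn2ereal ennreal.abs_eq)
  qed
  interpret galton_watson M A B "ennreal \<rho>"
  proof (intro galton_watson.intro branching.intro branching_axioms.intro)
    fix i :: 'd and j :: nat and G assume j: "1 \<le> j" and G: "G \<in> sets (past_algebra M env_space (env A B) 0)"
    have G0: "G \<in> sets F0" unfolding F0_def by (rule G)
    have "(\<integral>\<^sup>+\<omega>. of_nat (total (fst (env A B 1 \<omega>) (j, i))) * indicator G \<omega> \<partial>M)
        = (\<integral>\<^sup>+\<omega>. of_nat (total (A 1 j i \<omega>)) * indicator G \<omega> \<partial>M)"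
      using j by (simp add: env_def)
    \<comment> \<open>The mean hypothesis concerns only individual 1; equality of the conditional
      laws extends it to individual j.\<close>
    also have "\<dots> = (\<integral>\<^sup>+\<omega>. of_nat (total (A 1 1 i \<omega>)) * indicator G \<omega> \<partial>M)"
      by (rule same_cond_law_nn_integral[OF assms(2) sub A A _ same_law G0]) (use j in simp_all)
    also have "\<dots> \<le> ennreal \<rho> * emeasure M G"
      by (rule nn_integral_cond_mean_bound[OF assms(2) sub A mean_i G0]) simp
    finally show "(\<integral>\<^sup>+\<omega>. of_nat (total (fst (env A B 1 \<omega>) (j, i))) * indicator G \<omega> \<partial>M) \<le> ennreal \<rho> * emeasure M G" .
  next
    have "(\<integral>\<^sup>+\<omega>. of_nat (total (snd (env A B 1 \<omega>))) \<partial>M) = (\<integral>\<^sup>+\<omega>. ennreal (norm (l1_norm (real_vec (B 1 \<omega>)))) \<partial>M)"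
      by (simp add: env_def l1_norm_real_vec ennreal_of_nat_eq_real_of_nat)
    also have "\<dots> < \<infinity>" using assms(10) by (simp add: integrable_iff_bounded)
    finally show "(\<integral>\<^sup>+\<omega>. of_nat (total (snd (env A B 1 \<omega>))) \<partial>M) < \<infinity>" .
    show "ennreal \<rho> < 1" using assms(8) by (simp add: ennreal_less_one_iff)
  qed (rule assms)+
  show ?thesis using GW_strongly_stable GW_SLLN by blast
qed

end
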